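(* Let $n\ge 2$ and let $(X,w)$ be a Euclidean $t$-design in $\mathbb R^n$ supported by $p$ concentric spheres, $X=X_1\cup\cdots\cup X_p$ with $X_\nu=X\cap S^{n-1}(r_\nu)$. Assume that $w$ is constant on each layer, i.e. $w(\boldsymbol x)=w_\nu$ for all $\boldsymbol x\in X_\nu$ $(1\le\nu\le p)$. Assume moreover one of the following: (1) $s_{\lambda,\nu}+s_{\nu,\mu}\le t-2(p-\varepsilon_S-2)$ for all $\lambda,\nu,\mu\in\{1,\dots,p\}$ (with $X_\lambda,X_\nu,X_\mu\neq\{0\}$); (2) $X$ is antipodal (i.e. $X=-X$) and $s_{\lambda,\nu}+s_{\nu,\mu}-\delta_{\lambda,\nu}-\delta_{\nu,\mu}\le t-2(p-\varepsilon_S-2)$ for all $\lambda,\nu,\mu\in\{1,\dots,p\}$ (with $X_\lambda,X_\nu,X_\mu\neq\{0\}$), where $\delta$ is the Kronecker delta. Then $X$ has the structure of a coherent configuration.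
   Context: A weighted finite set $(X,w)$ in $\mathbb R^n$ is a finite set $X\subset\mathbb R^n$ with a weight $w:X\to\mathbb R_{>0}$. Write $X=X_1\cup\dots\cup X_p$ (disjoint, nonempty) with $X_i\subset S_i:=S^{n-1}(r_i)$, the sphere of radius $r_i$ centred at the origin, $r_1,\dots,r_p$ distinct nonnegative reals ($S_i=\{0\}$ if $r_i=0$); $X$ is then said to be supported by $p$ concentric spheres. Let $w(X_i)=\sum_{\boldsymbol x\in X_i}w(\boldsymbol x)$, let $\sigma_i$ be the surface measure on $S_i$ and $|S_i|=\int_{S_i}d\sigma_i$; for $r_i=0$ interpret $\frac1{|S_i|}\int_{S_i}f\,d\sigma_i=f(0)$. $(X,w)$ is a Euclidean $t$-design if $\sum_{i=1}^p\frac{w(X_i)}{|S_i|}\int_{S_i}f\,d\sigma_i=\sum_{\boldsymbol u\in X}w(\boldsymbol u)f(\boldsymbol u)$ for every real polynomial $f$ in $n$ variables of degree at most $t$. Put $\varepsilon_S=1$ if $0\in X$ and $\varepsilon_S=0$ otherwise. For $X_\lambda,X_\mu\ne\{0\}$ let $A(X_\lambda,X_\mu)=\{\frac{\boldsymbol x\cdot\boldsymbol y}{r_\lambda r_\mu}:\boldsymbol x\in X_\lambda,\boldsymbol y\in X_\mu,\boldsymbol x\ne\boldsymbol y\}$ and $s_{\lambda,\mu}=|A(X_\lambda,X_\mu)|$. A coherent configuration on a finite set $X$ is a partition of $X\times X$ into nonempty relations $R_0,\dots,R_d$ such that the diagonal of $X\times X$ is a union of some $R_i$, the transpose of each $R_i$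 is some $R_{i'}$, and for all $i,j,k$ and $(\boldsymbol x,\boldsymbol y)\in R_k$ the number of $\boldsymbol z\in X$ with $(\boldsymbol x,\boldsymbol z)\in R_i$, $(\boldsymbol z,\boldsymbol y)\in R_j$ depends only on $i,j,k$. "$X$ has the structure of a coherent configuration" means that the following partition of $X\times X$ is a coherent configuration: the classes $\{(\boldsymbol x,\boldsymbol y)\in X_\lambda\times X_\mu:\boldsymbol x\ne\boldsymbol y,\ \boldsymbol x\cdot\boldsymbol y=r_\lambda r_\mu\alpha\}$ for $X_\lambda,X_\mu\ne\{0\}$ and $\alpha\in A(X_\lambda,X_\mu)$, the diagonals $\{(\boldsymbol x,\boldsymbol x):\boldsymbol x\in X_\lambda\}$, and, if $0\in X$, the classes $\{(0,0)\}$, $\{0\}\times X_\mu$, $X_\lambda\times\{0\}$ for nonzero layers. *)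

theory Defs
  imports "HOL-Analysis.Analysis" "HOL-Library.Disjoint_Sets"
begin

section \<open>Surface measure and polynomials\<close>

text \<open>
  For \<open>r > 0\<close>, the surface measure on the sphere of radius \<open>r\<close> in \<open>n\<close>-space: a Borel set \<open>A\<close> of
  the sphere has area \<open>n / r\<close> times the volume of the solid cone over \<open>A\<close> with apex \<open>0\<close>.  The cone
  is the preimage of \<open>A\<close> under radial projection of the punctured ball, whence the push-forward;
  \<open>emeasure_surface_measure\<close> below states the cone formula explicitly.
\<close>

definition surface_measure :: "real \<Rightarrow> (real ^ 'n) measure" where
  "surface_measure r =
     scale_measure (ennreal (real CARD('n) / r))
       (distr (restrict_space lborel (cball 0 r - {0})) (restrict_space borel (sphere 0 r))
          (\<lambda>x. (r / norm x) *\<^sub>R x))"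

lemma emeasure_surface_measure:
  fixes A :: "(real ^ 'n) set"
  assumes r: "r > 0" and A: "A \<in> sets borel" "A \<subseteq> sphere 0 r"
  shows "emeasure (surface_measure r) A =
           ennreal (real CARD('n) / r) * emeasure lborel {s *\<^sub>R a |s a. 0 < s \<and> s \<le> 1 \<and> a \<in> A}"
proof -
  let ?B = "cball 0 r - {0 :: real ^ 'n}"
  let ?g = "\<lambda>x :: real ^ 'n. (r / norm x) *\<^sub>R x"
  have meas: "?g \<in> measurable (restrict_space lborel ?B) (restrict_space borel (sphere 0 r))"
  proof (rule measurable_restrict_space2)
    show "?g \<in> space (restrict_space lborel ?B) \<rightarrow> sphere 0 r"
      using r by (auto simp: space_restrict_space)
    show "?g \<in> borel_measurable (restrict_space lborel ?B)"
      by (rule measurable_restrict_space1) measurable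
  qed
  have cone: "?g -` A \<inter> ?B = {s *\<^sub>R a |s a. 0 < s \<and> s \<le> 1 \<and> a \<in> A}" (is "?L = ?R")
  proof (intro equalityI subsetI)
    fix x assume x: "x \<in> ?L"
    then have "x = (norm x / r) *\<^sub>R ?g x" "0 < norm x / r" "norm x / r \<le> 1" "?g x \<in> A"
      using r by auto
    then show "x \<in> ?R" by blast
  next
    fix x assume "x \<in> ?R"
    then obtain s a where sa: "x = s *\<^sub>R a" "0 < s" "s \<le> 1" "a \<in> A" by blast
    then have "norm a = r" using A by auto
    then show "x \<in> ?L" using sa r by (auto simp: mult_le_cancel_right1)
  qed
  have "A \<in> sets (restrict_space borel (sphere 0 r))"
    using A by (auto simp: sets_restrict_space image_iff)
  then have "emeasure (surface_measure r) A =
      ennreal (real CARD('n) / r) * emeasure (restrict_space lborel ?B) (?g -` A \<inter> ?B)"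
    using meas by (simp add: surface_measure_def emeasure_distr space_restrict_space)
  also have "emeasure (restrict_space lborel ?B) (?g -` A \<inter> ?B) = emeasure lborel (?g -` A \<inter> ?B)"
    by (rule emeasure_restrict_space) auto
  finally show ?thesis using cone by simp
qed

definition sphere_mean :: "real \<Rightarrow> (real ^ 'n \<Rightarrow> real) \<Rightarrow> real" where
  "sphere_mean r f =
     (if r = 0 then f 0
      else 1 / measure (surface_measure r :: (real ^ 'n) measure) (sphere 0 r)
             * (\<integral>x. f x \<partial>surface_measure r))"

text \<open>
  Real polynomials of degree at most \<open>t\<close> in the coordinates, as functions.  The multi-indices
  \<open>\<alpha> :: 'n \<Rightarrow> nat\<close> of total degree at most \<open>t\<close> form a finite set.
\<close>

definition poly_fun_le :: "nat \<Rightarrow> (real ^ 'n \<Rightarrow> real) \<Rightarrow> bool" where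
  "poly_fun_le t f \<longleftrightarrow>
     (\<exists>c :: ('n \<Rightarrow> nat) \<Rightarrow> real. \<forall>x.
        f x = (\<Sum>\<alpha> | (\<Sum>i\<in>UNIV. \<alpha> i) \<le> t. c \<alpha> * (\<Prod>i\<in>UNIV. (x $ i) ^ \<alpha> i)))"

lemma finite_multi_indices: "finite {\<alpha> :: 'n :: finite \<Rightarrow> nat. (\<Sum>i\<in>UNIV. \<alpha> i) \<le> t}"
proof (rule finite_subset)
  have "\<alpha> i \<le> t" if "(\<Sum>i\<in>UNIV. \<alpha> i) \<le> t" for \<alpha> :: "'n \<Rightarrow> nat" and i
    using member_le_sum[of i UNIV \<alpha>] that by simp
  then show "{\<alpha> :: 'n \<Rightarrow> nat. (\<Sum>i\<in>UNIV. \<alpha> i) \<le> t} \<subseteq> (UNIV :: 'n set) \<rightarrow>\<^sub>E {..t}"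
    by (simp add: PiE_UNIV_domain Pi_iff subset_iff)
qed (simp add: finite_PiE)

section \<open>Weighted sets on concentric spheres\<close>

definition layer :: "(real ^ 'n) set \<Rightarrow> (nat \<Rightarrow> real) \<Rightarrow> nat \<Rightarrow> (real ^ 'n) set" where
  "layer X r i = X \<inter> sphere 0 (r i)"

definition weighted_set :: "(real ^ 'n) set \<Rightarrow> (real ^ 'n \<Rightarrow> real) \<Rightarrow> bool" where
  "weighted_set X w \<longleftrightarrow> finite X \<and> (\<forall>x\<in>X. w x > 0)"

definition supported_by_spheres :: "(real ^ 'n) set \<Rightarrow> nat \<Rightarrow> (nat \<Rightarrow> real) \<Rightarrow> bool" where
  "supported_by_spheres X p r \<longleftrightarrow>
     inj_on r {1..p} \<and> (\<forall>i\<in>{1..p}. r i \<ge> 0) \<and>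
     X = (\<Union>i\<in>{1..p}. layer X r i) \<and> (\<forall>i\<in>{1..p}. layer X r i \<noteq> {})"

definition euclidean_design ::
    "nat \<Rightarrow> (real ^ 'n) set \<Rightarrow> (real ^ 'n \<Rightarrow> real) \<Rightarrow> nat \<Rightarrow> (nat \<Rightarrow> real) \<Rightarrow> bool" where
  "euclidean_design t X w p r \<longleftrightarrow>
     weighted_set X w \<and> supported_by_spheres X p r \<and>
     (\<forall>f. poly_fun_le t f \<longrightarrow>
        (\<Sum>i=1..p. (\<Sum>x\<in>layer X r i. w x) * sphere_mean (r i) f) = (\<Sum>u\<in>X. w u * f u))"

definition antipodal :: "(real ^ 'n) set \<Rightarrow> bool" where
  "antipodal X \<longleftrightarrow> X = uminus ` X"

text \<open>Only meant for layers other than \<open>{0}\<close>.\<close>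

definition angles :: "(real ^ 'n) set \<Rightarrow> (nat \<Rightarrow> real) \<Rightarrow> nat \<Rightarrow> nat \<Rightarrow> real set" where
  "angles X r l m =
     {(x \<bullet> y) / (r l * r m) | x y. x \<in> layer X r l \<and> y \<in> layer X r m \<and> x \<noteq> y}"

definition num_angles :: "(real ^ 'n) set \<Rightarrow> (nat \<Rightarrow> real) \<Rightarrow> nat \<Rightarrow> nat \<Rightarrow> nat" where
  "num_angles X r l m = card (angles X r l m)"

section \<open>Coherent configurations\<close>

definition coherent_configuration :: "'a set \<Rightarrow> ('a \<times> 'a) set set \<Rightarrow> bool" where
  "coherent_configuration X \<R> \<longleftrightarrow>
     finite X \<and> partition_on (X \<times> X) \<R> \<and>
     (\<exists>\<D>\<subseteq>\<R>. Id_on X = \<Union>\<D>) \<and>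
     (\<forall>R\<in>\<R>. R\<inverse> \<in> \<R>) \<and>
     (\<forall>Ri\<in>\<R>. \<forall>Rj\<in>\<R>. \<forall>Rk\<in>\<R>. \<exists>q. \<forall>(x, y)\<in>Rk.
        card {z \<in> X. (x, z) \<in> Ri \<and> (z, y) \<in> Rj} = q)"

definition angle_class ::
    "(real ^ 'n) set \<Rightarrow> (nat \<Rightarrow> real) \<Rightarrow> nat \<Rightarrow> nat \<Rightarrow> real \<Rightarrow> ((real ^ 'n) \<times> (real ^ 'n)) set" where
  "angle_class X r l m \<alpha> =
     {(x, y). x \<in> layer X r l \<and> y \<in> layer X r m \<and> x \<noteq> y \<and> x \<bullet> y = r l * r m * \<alpha>}"

definition angle_relations ::
    "(real ^ 'n) set \<Rightarrow> nat \<Rightarrow> (nat \<Rightarrow> real) \<Rightarrow> ((real ^ 'n) \<times> (real ^ 'n)) set set" where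
  "angle_relations X p r =
     {angle_class X r l m \<alpha> | l m \<alpha>. l \<in> {1..p} \<and> m \<in> {1..p} \<and>
        layer X r l \<noteq> {0} \<and> layer X r m \<noteq> {0} \<and> \<alpha> \<in> angles X r l m}
     \<union> {Id_on (layer X r l) | l. l \<in> {1..p}}
     \<union> (if 0 \<in> X then
          {{(0, 0)}}
          \<union> {{0} \<times> layer X r m | m. m \<in> {1..p} \<and> layer X r m \<noteq> {0}}
          \<union> {layer X r l \<times> {0} | l. l \<in> {1..p} \<and> layer X r l \<noteq> {0}}
        else {})"

end

theory Submission
  imports Defs
begin

text \<open>
  Membership in a relation is determined by \<open>(norm x, norm y, x = y, x \<bullet> y)\<close>, and two pairs with
  equal data are exchanged by an orthogonal map \<open>g\<close>.  Since surface measure is invariant under \<open>g\<close>,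
  the design property gives \<open>\<Sum>w u * F (g u) = \<Sum>w u * F u\<close> over \<open>X\<close> for every polynomial \<open>F\<close> of
  degree at most \<open>t\<close>, although \<open>g\<close> need not preserve \<open>X\<close>; the spherical means are never computed.
  Taking \<open>F z = (\<Prod>(z \<bullet> z - \<rho>\<^sup>2)) * P (x \<bullet> z) * Q (y \<bullet> z)\<close>, where \<open>\<rho>\<close> runs over the other nonzero
  radii and \<open>P\<close>, \<open>Q\<close> vanish at all inner products but one, turns this into an equality of the
  numbers of points \<open>z\<close> of one layer with prescribed \<open>x \<bullet> z\<close> and \<open>y \<bullet> z\<close>.
\<close>

section \<open>Reflections and orthogonal maps with prescribed values\<close>

text \<open>This is the reflection in the hyperplane orthogonal to \<open>v\<close>. For
  \<open>v = 0\<close> the quotient is \<open>0\<close> by convention and the map is the identity,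
  which serves the case \<open>a = b\<close> of the next lemma.\<close>

lemma orthogonal_transformation_minus_along:
  fixes v :: "'a::real_inner"
  shows "orthogonal_transformation (\<lambda>z. z - (2 * (z \<bullet> v) / (v \<bullet> v)) *\<^sub>R v)"
  unfolding orthogonal_transformation_def
proof (intro conjI allI)
  show "linear (\<lambda>z. z - (2 * (z \<bullet> v) / (v \<bullet> v)) *\<^sub>R v)"
    by (rule linearI) (simp_all add: inner_add_left distrib_left add_divide_distrib scaleR_add_left
        scaleR_right_diff_distrib mult.left_commute)
  fix z u
  \<comment> \<open>Naming the quotients gives division-free equations for the inner products with
    \<open>v\<close> that also hold for \<open>v = 0\<close>; the rest is ring algebra.\<close>
  define c d where "c = 2 * (z \<bullet> v) / (v \<bullet> v)" and "d = 2 * (u \<bullet> v) / (v \<bullet> v)"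
  have cd: "z \<bullet> v = c * (v \<bullet> v) / 2" "u \<bullet> v = d * (v \<bullet> v) / 2"
    unfolding c_def d_def by (cases "v = 0"; simp)+
  show "(z - (2 * (z \<bullet> v) / (v \<bullet> v)) *\<^sub>R v) \<bullet> (u - (2 * (u \<bullet> v) / (v \<bullet> v)) *\<^sub>R v) = z \<bullet> u"
    unfolding c_def[symmetric] d_def[symmetric]
    by (simp add: inner_diff_left inner_diff_right inner_commute[of v u] cd algebra_simps)
qed

text \<open>Equal norms put the hyperplane bisecting \<open>a\<close> and \<open>b\<close> through
  the origin, so the reflection in it is linear. Its fixed points matter too: they keep an already
  placed point where it is during a second reflection.\<close>

lemma orthogonal_transformation_swap:
  fixes a b :: "'a::real_inner"
  assumes "norm a = norm b"
  obtains g where "orthogonal_transformation g" "g a = b"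
    and "\<And>z. z \<bullet> a = z \<bullet> b \<Longrightarrow> g z = z"
proof
  let ?v = "a - b"
  let ?g = "\<lambda>z. z - (2 * (z \<bullet> ?v) / (?v \<bullet> ?v)) *\<^sub>R ?v"
  show "orthogonal_transformation ?g" by (rule orthogonal_transformation_minus_along)
  have "a \<bullet> a = b \<bullet> b" using assms by (simp only: norm_eq)
  then have "2 * (a \<bullet> ?v) = ?v \<bullet> ?v" by (simp add: inner_simps inner_commute)
  then show "?g a = b" by (cases "?v = 0") simp_all
  show "?g z = z" if "z \<bullet> a = z \<bullet> b" for z using that by (simp add: inner_simps)
qed

text \<open>Two reflections suffice. The first takes \<open>x\<close> to \<open>x'\<close>; the
  second takes \<open>g y\<close> to \<open>y'\<close> and fixes \<open>x'\<close>, because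
  \<open>x'\<close> has the same inner product with both.\<close>

lemma orthogonal_transformation_pair:
  fixes x y x' y' :: "'a::real_inner"
  assumes "norm x = norm x'" "norm y = norm y'" "x \<bullet> y = x' \<bullet> y'"
  obtains g where "orthogonal_transformation g" "g x = x'" "g y = y'"
proof -
  obtain g where g: "orthogonal_transformation g" "g x = x'"
    using orthogonal_transformation_swap[OF assms(1)] by metis
  have "norm (g y) = norm y'" and "x' \<bullet> g y = x' \<bullet> y'"
    using assms g by (auto simp: orthogonal_transformation_norm orthogonal_transformation_def)
  then obtain h where h: "orthogonal_transformation h" "h (g y) = y'" "h x' = x'"
    using orthogonal_transformation_swap by metis
  show thesis
    by (rule that[of "h \<circ> g"]) (use g h in \<open>auto intro: orthogonal_transformation_compose\<close>)
qed

section \<open>Invariance of Lebesgue measure, surface measure and sphere means\<close>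

lemma orthogonal_transformation_measurable:
  fixes g :: "'a::euclidean_space \<Rightarrow> 'a"
  assumes "orthogonal_transformation g"
  shows "g \<in> borel_measurable borel"
  using assms
  by (intro borel_measurable_continuous_onI linear_continuous_on linear_conv_bounded_linear[THEN iffD1])
     (simp add: orthogonal_transformation_linear)

lemma nn_integral_lborel_translate:
  fixes f :: "'a::euclidean_space \<Rightarrow> ennreal"
  assumes [measurable]: "f \<in> borel_measurable borel"
  shows "(\<integral>\<^sup>+x. f (c + x) \<partial>lborel) = (\<integral>\<^sup>+x. f x \<partial>lborel)"
proof -
  have "(\<integral>\<^sup>+x. f x \<partial>lborel) = (\<integral>\<^sup>+x. f x \<partial>distr lborel borel ((+) c))"
    by (simp only: lborel_distr_plus)
  also have "\<dots> = (\<integral>\<^sup>+x. f (c + x) \<partial>lborel)"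
    by (rule nn_integral_distr) auto
  finally show ?thesis ..
qed

text \<open>
  The argument for uniqueness of Haar measure: integrating \<open>1\<^sub>A x * 1\<^sub>B (x - g y)\<close>, with \<open>B\<close> the
  unit ball, in both orders compares \<open>A\<close> with its preimage, because \<open>g\<close> maps balls to balls.
  (The library's change of variables requires a well-ordered index type.)
\<close>
lemma lborel_distr_orthogonal:
  fixes g :: "'a::euclidean_space \<Rightarrow> 'a"
  assumes g: "orthogonal_transformation g"
  shows "distr lborel borel g = lborel"
proof (rule measure_eqI)
  show "sets (distr lborel borel g) = sets lborel" by simp
  fix A assume "A \<in> sets (distr lborel borel g)"
  then have A [measurable]: "A \<in> sets borel" by simp
  note [measurable] = orthogonal_transformation_measurable[OF g]
  let ?B = "ball 0 1 :: 'a set"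
  let ?v = "emeasure lborel ?B"
  have [measurable]: "?B \<in> sets borel" by (rule borel_open) simp
  define iA iB :: "'a \<Rightarrow> ennreal" where "iA = indicator A" and "iB = indicator ?B"
  have [measurable]: "iA \<in> borel_measurable borel" "iB \<in> borel_measurable borel"
    by (simp_all add: iA_def iB_def)
  have int_iA: "(\<integral>\<^sup>+x. iA x \<partial>lborel) = emeasure lborel A" and int_iB: "(\<integral>\<^sup>+x. iB x \<partial>lborel) = ?v"
    by (simp_all add: iA_def iB_def)
  have lin: "linear g" using g by (rule orthogonal_transformation_linear)
  have vA: "g -` A \<in> sets borel" using measurable_sets[OF orthogonal_transformation_measurable[OF g] A] by simp
  have surj: "\<exists>y. x = g y" for x using orthogonal_transformation_surj[OF g] by (metis surjD)
  \<comment> \<open>Writing \<open>x = g u\<close> and translating by \<open>u\<close> turns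
    \<open>x - g y\<close> into \<open>- g y\<close>, which lies in the ball exactly when
    \<open>y\<close> does. So the inner integral does not depend on \<open>x\<close>.\<close>
  have "(\<integral>\<^sup>+y. iB (x - g y) \<partial>lborel) = ?v" for x
  proof -
    obtain u where u: "x = g u" using surj by blast
    have "iB (x - g (u + y)) = iB y" for y
    proof -
      have "x - g (u + y) = - g y" unfolding u linear_add[OF lin] by simp
      then show ?thesis using orthogonal_transformation_norm[OF g, of y] by (simp add: iB_def indicator_def)
    qed
    then have "(\<integral>\<^sup>+y. iB (x - g (u + y)) \<partial>lborel) = ?v" by (simp add: int_iB)
    then show ?thesis
      by (subst (asm) nn_integral_lborel_translate[where f = "\<lambda>y. iB (x - g y)"]) measurable
  qed
  then have "emeasure lborel A * ?v = (\<integral>\<^sup>+x. iA x * (\<integral>\<^sup>+y. iB (x - g y) \<partial>lborel) \<partial>lborel)"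
    by (simp add: nn_integral_multc int_iA)
  also have "\<dots> = (\<integral>\<^sup>+x. (\<integral>\<^sup>+y. iA x * iB (x - g y) \<partial>lborel) \<partial>lborel)"
    by (simp add: nn_integral_cmult)
  also have "\<dots> = (\<integral>\<^sup>+y. (\<integral>\<^sup>+x. iA x * iB (x - g y) \<partial>lborel) \<partial>lborel)"
    by (rule lborel_pair.Fubini') measurable
  \<comment> \<open>Translating \<open>x\<close> by \<open>g y\<close> removes \<open>y\<close> from
    the ball factor, so that after a second exchange of the integrals only \<open>iA\<close> depends
    on \<open>y\<close>.\<close>
  also have "\<dots> = (\<integral>\<^sup>+y. (\<integral>\<^sup>+x. iA (g y + x) * iB x \<partial>lborel) \<partial>lborel)"
  proof (rule nn_integral_cong)
    fix y show "(\<integral>\<^sup>+x. iA x * iB (x - g y) \<partial>lborel)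
        = (\<integral>\<^sup>+x. iA (g y + x) * iB x \<partial>lborel)"
      by (subst nn_integral_lborel_translate[where c = "g y", symmetric]) auto
  qed
  also have "\<dots> = (\<integral>\<^sup>+x. (\<integral>\<^sup>+y. iA (g y + x) * iB x \<partial>lborel) \<partial>lborel)"
    by (rule lborel_pair.Fubini'[symmetric]) measurable
  also have "\<dots> = (\<integral>\<^sup>+x. emeasure lborel (g -` A) * iB x \<partial>lborel)"
  proof (rule nn_integral_cong)
    fix x
    obtain u where u: "x = g u" using surj by blast
    have "(\<integral>\<^sup>+y. iA (g y + x) \<partial>lborel) = (\<integral>\<^sup>+y. iA (g (u + y)) \<partial>lborel)"
      unfolding u linear_add[OF lin] by (simp only: add.commute)
    also have "\<dots> = (\<integral>\<^sup>+y. iA (g y) \<partial>lborel)"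
      by (rule nn_integral_lborel_translate[where f = "\<lambda>y. iA (g y)"]) measurable
    also have "\<dots> = (\<integral>\<^sup>+y. indicator (g -` A) y \<partial>lborel)"
      by (simp add: iA_def indicator_def)
    also have "\<dots> = emeasure lborel (g -` A)"
      using vA by (simp add: nn_integral_indicator)
    finally show "(\<integral>\<^sup>+y. iA (g y + x) * iB x \<partial>lborel)
        = emeasure lborel (g -` A) * iB x"
      by (simp add: nn_integral_multc)
  qed
  also have "\<dots> = emeasure lborel (g -` A) * ?v"
    by (simp add: nn_integral_cmult int_iB)
  finally have "?v * emeasure lborel A = ?v * emeasure lborel (g -` A)" by (simp add: mult.commute)
  \<comment> \<open>The volume of the ball can be cancelled because it is neither zero nor
    infinite.\<close>
  moreover have "?v \<noteq> 0"
    using content_ball_pos[of 1 "0::'a"] by (auto simp: measure_def)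
  moreover have "?v \<noteq> top"
    using emeasure_lborel_ball_finite[of "0::'a" 1] by simp
  ultimately show "emeasure (distr lborel borel g) A = emeasure lborel A"
    by (simp add: emeasure_distr ennreal_mult_cancel_left)
qed

lemma sets_surface_measure [measurable_cong]:
  "sets (surface_measure r) = sets (restrict_space borel (sphere 0 r))"
  by (simp add: surface_measure_def)

lemma space_surface_measure: "space (surface_measure r) = sphere 0 r"
  by (simp add: surface_measure_def space_scale_measure space_restrict_space)

text \<open>Radial projection commutes with \<open>g\<close>, and \<open>g\<close> preserves the
  punctured ball. Hence the cone over the preimage of a set is the preimage of its cone, and
  invariance descends from Lebesgue measure.\<close>

lemma surface_measure_distr_orthogonal:
  fixes g :: "real ^ 'n \<Rightarrow> real ^ 'n"
  assumes r: "r > 0" and g: "orthogonal_transformation g"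
  shows "g \<in> measurable (surface_measure r) (surface_measure r)"
    and "distr (surface_measure r) (surface_measure r) g = surface_measure r"
proof -
  let ?B = "cball 0 r - {0 :: real ^ 'n}" and ?S = "sphere 0 r :: (real ^ 'n) set"
  let ?h = "\<lambda>x :: real ^ 'n. (r / norm x) *\<^sub>R x"
  note norm_g = orthogonal_transformation_norm[OF g]
  have bg [measurable]: "g \<in> borel_measurable borel" by (rule orthogonal_transformation_measurable[OF g])
  show gm: "g \<in> measurable (surface_measure r) (surface_measure r)"
    unfolding measurable_cong_sets[OF sets_surface_measure sets_surface_measure]
    by (rule measurable_restrict_space3) (auto simp: norm_g)
  have meas: "?h \<in> measurable (restrict_space lborel ?B) (restrict_space borel ?S)"
  proof (rule measurable_restrict_space2)
    show "?h \<in> space (restrict_space lborel ?B) \<rightarrow> ?S"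
      using r by (auto simp: space_restrict_space)
    show "?h \<in> borel_measurable (restrict_space lborel ?B)"
      by (rule measurable_restrict_space1) measurable
  qed
  have em: "emeasure (surface_measure r) A = ennreal (real CARD('n) / r) * emeasure lborel (?h -` A \<inter> ?B)"
    "?h -` A \<inter> ?B \<in> sets borel" if "A \<in> sets (restrict_space borel ?S)" for A
  proof -
    have "emeasure (restrict_space lborel ?B) (?h -` A \<inter> ?B) = emeasure lborel (?h -` A \<inter> ?B)"
      by (rule emeasure_restrict_space) auto
    then show "emeasure (surface_measure r) A = ennreal (real CARD('n) / r) * emeasure lborel (?h -` A \<inter> ?B)"
      using meas that by (simp add: surface_measure_def emeasure_distr space_restrict_space)
    show "?h -` A \<inter> ?B \<in> sets borel"
      using measurable_sets[OF meas that] by (auto simp: space_restrict_space sets_restrict_space)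
  qed
  show "distr (surface_measure r) (surface_measure r) g = surface_measure r"
  proof (rule measure_eqI)
    fix A assume "A \<in> sets (distr (surface_measure r) (surface_measure r) g)"
    then have A: "A \<in> sets (restrict_space borel ?S)" by (simp add: sets_surface_measure)
    have vA: "g -` A \<inter> ?S \<in> sets (restrict_space borel ?S)"
      using measurable_sets[OF gm, of A] A by (simp add: sets_surface_measure space_surface_measure)
    have zero: "g x = 0 \<longleftrightarrow> x = 0" for x
      using norm_g[of x] by (metis norm_eq_zero)
    have "?h (g x) = g (?h x)" for x
      by (simp add: norm_g orthogonal_transformation_scaleR[OF g])
    moreover have "norm (?h x) = r" if "x \<noteq> 0" for x
      using that r by simp
    ultimately have "?h -` (g -` A \<inter> ?S) \<inter> ?B = g -` (?h -` A \<inter> ?B)"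
      by (auto simp: norm_g zero simp del: norm_scaleR)
    then have "emeasure lborel (?h -` (g -` A \<inter> ?S) \<inter> ?B) = emeasure (distr lborel borel g) (?h -` A \<inter> ?B)"
      using em(2)[OF A] by (simp add: emeasure_distr)
    also have "\<dots> = emeasure lborel (?h -` A \<inter> ?B)" by (simp add: lborel_distr_orthogonal[OF g])
    finally show "emeasure (distr (surface_measure r) (surface_measure r) g) A = emeasure (surface_measure r) A"
      using A em(1)[OF A] em(1)[OF vA] gm
      by (simp add: emeasure_distr sets_surface_measure space_surface_measure)
  qed simp
qed

text \<open>Change of variables for the Bochner integral asks only for measurability: if
  \<open>f\<close> is not integrable, both integrals are \<open>0\<close> by convention. At radius
  \<open>0\<close> the mean is evaluation at the origin, a fixed point of \<open>g\<close>.\<close>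

lemma sphere_mean_orthogonal:
  fixes g :: "real ^ 'n \<Rightarrow> real ^ 'n"
  assumes "r \<ge> 0" and g: "orthogonal_transformation g" and f: "f \<in> borel_measurable borel"
  shows "sphere_mean r (\<lambda>x. f (g x)) = sphere_mean r f"
proof (cases "r = 0")
  case True
  then show ?thesis
    by (simp add: sphere_mean_def linear_0[OF orthogonal_transformation_linear[OF g]])
next
  case False
  with \<open>r \<ge> 0\<close> have r: "r > 0" by simp
  have "f \<in> borel_measurable (surface_measure r)"
    unfolding measurable_cong_sets[OF sets_surface_measure refl] using f by (rule measurable_restrict_space1)
  then have "(\<integral>x. f x \<partial>distr (surface_measure r) (surface_measure r) g) = (\<integral>x. f (g x) \<partial>surface_measure r)"
    by (intro integral_distr surface_measure_distr_orthogonal[OF r g])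
  then show ?thesis
    using r by (simp add: sphere_mean_def surface_measure_distr_orthogonal(2)[OF r g])
qed

section \<open>Closure properties and degrees of polynomial functions\<close>

lemma poly_fun_le_add:
  assumes "poly_fun_le t f" "poly_fun_le t g"
  shows "poly_fun_le t (\<lambda>x. f x + g x)"
proof -
  obtain c d where "\<And>x. f x = (\<Sum>\<alpha> | (\<Sum>i\<in>UNIV. \<alpha> i) \<le> t. c \<alpha> * (\<Prod>i\<in>UNIV. (x $ i) ^ \<alpha> i))"
    "\<And>x. g x = (\<Sum>\<alpha> | (\<Sum>i\<in>UNIV. \<alpha> i) \<le> t. d \<alpha> * (\<Prod>i\<in>UNIV. (x $ i) ^ \<alpha> i))"
    using assms unfolding poly_fun_le_def by blast
  then show ?thesis unfolding poly_fun_le_def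
    by (intro exI[of _ "\<lambda>\<alpha>. c \<alpha> + d \<alpha>"]) (simp add: distrib_right sum.distrib)
qed

lemma poly_fun_le_cmult:
  assumes "poly_fun_le t f"
  shows "poly_fun_le t (\<lambda>x. a * f x)"
proof -
  obtain c where "\<And>x. f x = (\<Sum>\<alpha> | (\<Sum>i\<in>UNIV. \<alpha> i) \<le> t. c \<alpha> * (\<Prod>i\<in>UNIV. (x $ i) ^ \<alpha> i))"
    using assms unfolding poly_fun_le_def by blast
  then show ?thesis unfolding poly_fun_le_def
    by (intro exI[of _ "\<lambda>\<alpha>. a * c \<alpha>"]) (simp add: sum_distrib_left mult.assoc)
qed

lemma poly_fun_le_monomial:
  assumes "(\<Sum>i\<in>UNIV. \<alpha> i) \<le> t"
  shows "poly_fun_le t (\<lambda>x :: real ^ 'n. \<Prod>i\<in>UNIV. (x $ i) ^ \<alpha> i)"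
  unfolding poly_fun_le_def
proof (intro exI allI)
  fix x :: "real ^ 'n"
  \<comment> \<open>The witness is the coefficient family that is 1 at \<alpha> and 0
    elsewhere.\<close>
  have "(\<Sum>\<beta> | (\<Sum>i\<in>UNIV. \<beta> i) \<le> t. of_bool (\<beta> = \<alpha>) * (\<Prod>i\<in>UNIV. (x $ i) ^ \<beta> i))
      = (\<Sum>\<beta> | (\<Sum>i\<in>UNIV. \<beta> i) \<le> t. if \<beta> = \<alpha> then \<Prod>i\<in>UNIV. (x $ i) ^ \<beta> i else 0)"
    by (intro sum.cong) auto
  also have "\<dots> = (\<Prod>i\<in>UNIV. (x $ i) ^ \<alpha> i)"
    using assms by (simp add: sum.delta finite_multi_indices)
  finally show "(\<Prod>i\<in>UNIV. (x $ i) ^ \<alpha> i)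
      = (\<Sum>\<beta> | (\<Sum>i\<in>UNIV. \<beta> i) \<le> t. of_bool (\<beta> = \<alpha>) * (\<Prod>i\<in>UNIV. (x $ i) ^ \<beta> i))" ..
qed

lemma poly_fun_le_const [simp]: "poly_fun_le t (\<lambda>x. a)"
  using poly_fun_le_cmult[OF poly_fun_le_monomial[of "\<lambda>_. 0" t], of a] by simp

lemma poly_fun_le_sum:
  assumes "\<And>i. i \<in> I \<Longrightarrow> poly_fun_le t (f i)"
  shows "poly_fun_le t (\<lambda>x. \<Sum>i\<in>I. f i x)"
  using assms by (induction I rule: infinite_finite_induct) (auto intro: poly_fun_le_add)

lemma poly_fun_le_mult:
  assumes "poly_fun_le s f" "poly_fun_le t g"
  shows "poly_fun_le (s + t) (\<lambda>x. f x * g x)"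
proof -
  obtain c d where cd: "\<And>x. f x = (\<Sum>\<alpha> | (\<Sum>i\<in>UNIV. \<alpha> i) \<le> s. c \<alpha> * (\<Prod>i\<in>UNIV. (x $ i) ^ \<alpha> i))"
    "\<And>x. g x = (\<Sum>\<alpha> | (\<Sum>i\<in>UNIV. \<alpha> i) \<le> t. d \<alpha> * (\<Prod>i\<in>UNIV. (x $ i) ^ \<alpha> i))"
    using assms unfolding poly_fun_le_def by blast
  have "f x * g x = (\<Sum>\<alpha> | (\<Sum>i\<in>UNIV. \<alpha> i) \<le> s. \<Sum>\<beta> | (\<Sum>i\<in>UNIV. \<beta> i) \<le> t.
      (c \<alpha> * d \<beta>) * (\<Prod>i\<in>UNIV. (x $ i) ^ (\<alpha> i + \<beta> i)))" for x
    unfolding cd sum_product by (intro sum.cong refl) (simp add: power_add prod.distrib mult_ac)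
  moreover have "poly_fun_le (s + t) (\<lambda>x. \<Sum>\<alpha> | (\<Sum>i\<in>UNIV. \<alpha> i) \<le> s. \<Sum>\<beta> | (\<Sum>i\<in>UNIV. \<beta> i) \<le> t.
      (c \<alpha> * d \<beta>) * (\<Prod>i\<in>UNIV. (x $ i) ^ (\<alpha> i + \<beta> i)))"
    by (intro poly_fun_le_sum poly_fun_le_cmult poly_fun_le_monomial) (simp add: sum.distrib add_mono)
  ultimately show ?thesis by simp
qed

lemma poly_fun_le_mono:
  assumes "poly_fun_le s f" "s \<le> t"
  shows "poly_fun_le t f"
  \<comment> \<open>The constant 1 counts as a polynomial of degree at most \<open>t - s\<close>, so
    multiplying by it raises the bound.\<close>
  using poly_fun_le_mult[OF assms(1) poly_fun_le_const[of "t - s" 1]] assms(2) by simp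

lemma poly_fun_le_prod:
  assumes "finite I" "\<And>i. i \<in> I \<Longrightarrow> poly_fun_le (d i) (f i)"
  shows "poly_fun_le (\<Sum>i\<in>I. d i) (\<lambda>x. \<Prod>i\<in>I. f i x)"
  using assms by (induction I rule: finite_induct) (auto intro: poly_fun_le_mult)

lemma poly_fun_le_power:
  assumes "poly_fun_le d f"
  shows "poly_fun_le (k * d) (\<lambda>x. f x ^ k)"
  using poly_fun_le_prod[of "{..<k}" "\<lambda>_. d" "\<lambda>_. f"] assms by simp

lemma poly_fun_le_coordinate: "poly_fun_le 1 (\<lambda>x :: real ^ 'n. x $ i)"
proof -
  have "(\<Prod>j\<in>UNIV. (x $ j) ^ (if j = i then 1 else 0)) = x $ i" for x :: "real ^ 'n"
    by (subst prod.cong[where h = "\<lambda>j. if j = i then x $ j else 1"]) (auto simp: prod.delta)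
  then show ?thesis
    using poly_fun_le_monomial[of "\<lambda>j. if j = i then 1 else 0" 1] by (simp add: sum.delta cong: if_cong)
qed

lemma poly_fun_le_inner: "poly_fun_le 1 (\<lambda>z :: real ^ 'n. a \<bullet> z)"
  unfolding inner_vec_def inner_real_def
  by (intro poly_fun_le_sum poly_fun_le_cmult poly_fun_le_coordinate)

lemma poly_fun_le_inner_self: "poly_fun_le 2 (\<lambda>z :: real ^ 'n. z \<bullet> z)"
proof -
  have "poly_fun_le (1 + 1) (\<lambda>z :: real ^ 'n. z $ i * z $ i)" for i
    by (intro poly_fun_le_mult poly_fun_le_coordinate)
  then show ?thesis
    unfolding inner_vec_def inner_real_def by (intro poly_fun_le_sum) (simp add: numeral_2_eq_2)
qed

lemma poly_fun_le_diff_const: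
  assumes "poly_fun_le t f"
  shows "poly_fun_le t (\<lambda>x. f x - a)"
  using poly_fun_le_add[OF assms poly_fun_le_const[of t "- a"]] by simp

text \<open>Each coordinate of \<open>g x\<close> is the inner product of \<open>x\<close> with the
  adjoint image of a basis vector, hence has degree at most 1; substituting such forms into a
  monomial does not raise its degree.\<close>

lemma poly_fun_le_linear_comp:
  fixes g :: "real ^ 'n \<Rightarrow> real ^ 'n"
  assumes f: "poly_fun_le t f" and g: "linear g"
  shows "poly_fun_le t (\<lambda>x. f (g x))"
proof -
  obtain c where c: "\<And>x. f x = (\<Sum>\<alpha> | (\<Sum>i\<in>UNIV. \<alpha> i) \<le> t. c \<alpha> * (\<Prod>i\<in>UNIV. (x $ i) ^ \<alpha> i))"
    using f unfolding poly_fun_le_def by blast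
  have "g x $ i = adjoint g (axis i 1) \<bullet> x" for x i
    using adjoint_clauses(2)[OF g, of "axis i 1" x] by (simp add: inner_axis inner_commute)
  then have lin: "poly_fun_le 1 (\<lambda>x. g x $ i)" for i
    using poly_fun_le_inner by simp
  have "poly_fun_le t (\<lambda>x. \<Prod>i\<in>UNIV. (g x $ i) ^ \<alpha> i)" if "(\<Sum>i\<in>UNIV. \<alpha> i) \<le> t" for \<alpha>
    by (rule poly_fun_le_mono[OF poly_fun_le_prod that]) (use poly_fun_le_power[OF lin] in auto)
  then show ?thesis
    unfolding c by (intro poly_fun_le_sum poly_fun_le_cmult) auto
qed

lemma poly_fun_le_measurable:
  assumes "poly_fun_le t f"
  shows "f \<in> borel_measurable borel"
proof -
  obtain c where c: "\<And>x. f x = (\<Sum>\<alpha> | (\<Sum>i\<in>UNIV. \<alpha> i) \<le> t. c \<alpha> * (\<Prod>i\<in>UNIV. (x $ i) ^ \<alpha> i))"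
    using assms unfolding poly_fun_le_def by blast
  have "f = (\<lambda>x. \<Sum>\<alpha> | (\<Sum>i\<in>UNIV. \<alpha> i) \<le> t. c \<alpha> * (\<Prod>i\<in>UNIV. (x $ i) ^ \<alpha> i))"
    by (rule ext) (rule c)
  then show ?thesis
    by (auto intro!: borel_measurable_continuous_onI continuous_intros)
qed

section \<open>Transfer of weighted sums along an orthogonal map\<close>

text \<open>The functions \<open>f\<close> and \<open>f \<circ> g\<close> obey the same degree bound
  and have the same mean on every sphere, so their design identities share one left-hand
  side.\<close>

lemma euclidean_design_orthogonal:
  fixes g :: "real ^ 'n \<Rightarrow> real ^ 'n"
  assumes des: "euclidean_design t X w p r" and g: "orthogonal_transformation g" and f: "poly_fun_le t f"
  shows "(\<Sum>u\<in>X. w u * f (g u)) = (\<Sum>u\<in>X. w u * f u)"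
proof -
  have r: "\<forall>i\<in>{1..p}. r i \<ge> 0"
    using des by (simp add: euclidean_design_def supported_by_spheres_def)
  have eq: "(\<Sum>i=1..p. (\<Sum>x\<in>layer X r i. w x) * sphere_mean (r i) h) = (\<Sum>u\<in>X. w u * h u)"
    if "poly_fun_le t h" for h
    using des that by (simp add: euclidean_design_def)
  have "(\<Sum>u\<in>X. w u * f (g u)) = (\<Sum>i=1..p. (\<Sum>x\<in>layer X r i. w x) * sphere_mean (r i) (\<lambda>x. f (g x)))"
    using eq[OF poly_fun_le_linear_comp[OF f orthogonal_transformation_linear[OF g]]] by simp
  also have "\<dots> = (\<Sum>i=1..p. (\<Sum>x\<in>layer X r i. w x) * sphere_mean (r i) f)"
    using r by (intro sum.cong refl) (simp add: sphere_mean_orthogonal[OF _ g poly_fun_le_measurable[OF f]])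
  also have "\<dots> = (\<Sum>u\<in>X. w u * f u)" by (rule eq[OF f])
  finally show ?thesis .
qed

text \<open>The product \<open>?H\<close> isolates one shell: it vanishes on the other nonzero
  shells, is unchanged by \<open>g\<close>, and is a nonzero constant on the shell of radius
  \<open>c\<close>, so it cancels together with the common weight. Each excluded shell costs degree
  2.\<close>

lemma shell_sum_orthogonal:
  fixes X :: "(real ^ 'n) set"
  assumes des: "euclidean_design t X w p r"
    and wc: "\<And>x y. x \<in> X \<Longrightarrow> y \<in> X \<Longrightarrow> norm x = norm y \<Longrightarrow> w x = w y"
    and g: "orthogonal_transformation g"
    and f: "poly_fun_le d f"
    and deg: "d + 2 * card (norm ` X - {0, c}) \<le> t"
    and c: "c \<noteq> 0"
  shows "(\<Sum>z | z \<in> X \<and> norm z = c. f (g z)) = (\<Sum>z | z \<in> X \<and> norm z = c. f z)"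
proof (cases "c \<in> norm ` X")
  case False
  then have "{z \<in> X. norm z = c} = {}" by auto
  then show ?thesis by (simp only: sum.empty)
next
  case True
  then obtain z0 where z0: "z0 \<in> X" "norm z0 = c" by auto
  have fin: "finite X" and wpos: "\<And>x. x \<in> X \<Longrightarrow> w x > 0"
    using des by (auto simp: euclidean_design_def weighted_set_def)
  let ?R = "norm ` X - {0, c}"
  let ?H = "\<lambda>z :: real ^ 'n. \<Prod>\<rho>\<in>?R. (z \<bullet> z - \<rho>\<^sup>2)"
  have H: "poly_fun_le (\<Sum>\<rho>\<in>?R. 2) ?H"
    using fin by (intro poly_fun_le_prod poly_fun_le_diff_const poly_fun_le_inner_self) auto
  have "poly_fun_le t (\<lambda>z. ?H z * f z)"
    by (rule poly_fun_le_mono[OF poly_fun_le_mult[OF H f]]) (use deg in simp)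
  from euclidean_design_orthogonal[OF des g this]
  have "(\<Sum>u\<in>X. w u * (?H (g u) * f (g u))) = (\<Sum>u\<in>X. w u * (?H u * f u))" .
  moreover have "?H (g u) = ?H u" for u
    using g by (simp add: orthogonal_transformation_def)
  ultimately have "(\<Sum>u\<in>X. w u * (?H u * (f (g u) - f u))) = 0"
    by (simp add: right_diff_distrib sum_subtractf)
  also have "(\<Sum>u\<in>X. w u * (?H u * (f (g u) - f u)))
      = (\<Sum>u | u \<in> X \<and> norm u = c. w u * (?H u * (f (g u) - f u)))"
  proof (rule sum.mono_neutral_right[OF fin])
    show "\<forall>u\<in>X - {u \<in> X. norm u = c}. w u * (?H u * (f (g u) - f u)) = 0"
    proof
      fix u assume u: "u \<in> X - {u \<in> X. norm u = c}"
      show "w u * (?H u * (f (g u) - f u)) = 0"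
      \<comment> \<open>At the origin \<open>?H\<close> may be nonzero, but \<open>g\<close> fixes
        the origin and the difference vanishes. No factor is spent on radius 0; this is the gain
        that \<epsilon> records in the main bound.\<close>
      proof (cases "u = 0")
        case True
        then show ?thesis by (simp add: linear_0[OF orthogonal_transformation_linear[OF g]])
      next
        case False
        then have "norm u \<in> ?R" using u by auto
        moreover have "u \<bullet> u - (norm u)\<^sup>2 = 0" by (simp add: power2_norm_eq_inner)
        ultimately have "?H u = 0" using fin by (intro prod_zero) auto
        then show ?thesis by simp
      qed
    qed
  qed auto
  also have "\<dots> = (\<Sum>u | u \<in> X \<and> norm u = c. (w z0 * ?H z0) * (f (g u) - f u))"
  proof (rule sum.cong[OF refl])
    fix u assume u: "u \<in> {u \<in> X. norm u = c}"
    then have "w u = w z0" using z0 by (intro wc) auto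
    moreover have "u \<bullet> u = z0 \<bullet> z0" using u z0 by (simp add: norm_eq[symmetric])
    ultimately show "w u * (?H u * (f (g u) - f u)) = (w z0 * ?H z0) * (f (g u) - f u)"
      by (simp only: mult.assoc)
  qed
  also have "\<dots> = (w z0 * ?H z0) * (\<Sum>u | u \<in> X \<and> norm u = c. f (g u) - f u)"
    by (simp only: sum_distrib_left)
  finally have eq: "(w z0 * ?H z0) * (\<Sum>u | u \<in> X \<and> norm u = c. f (g u) - f u) = 0" .
  \<comment> \<open>Norms are nonnegative, so different radii have different squares.\<close>
  have "z0 \<bullet> z0 - \<rho>\<^sup>2 \<noteq> 0" if "\<rho> \<in> ?R" for \<rho>
  proof -
    have "\<rho> \<ge> 0" "\<rho> \<noteq> c" "c \<ge> 0" using that z0 by auto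
    then have "\<rho>\<^sup>2 \<noteq> c\<^sup>2" by (simp add: power2_eq_iff_nonneg)
    moreover have "z0 \<bullet> z0 = c\<^sup>2" unfolding z0(2)[symmetric] power2_norm_eq_inner ..
    ultimately show ?thesis by simp
  qed
  then have "?H z0 \<noteq> 0" using fin by (simp add: prod_zero_iff)
  with eq wpos[OF z0(1)] show ?thesis by (simp add: sum_subtractf)
qed

section \<open>Pair types and counting points with prescribed inner products\<close>

text \<open>Equality is an entry of its own, to match the separation of diagonal classes from angle
  classes, which demand \<open>x \<noteq> y\<close>.\<close>

definition pair_type :: "'a::real_inner \<Rightarrow> 'a \<Rightarrow> real \<times> real \<times> bool \<times> real" where
  "pair_type x y = (norm x, norm y, x = y, x \<bullet> y)"

lemma pair_type_orthogonal:
  "orthogonal_transformation g \<Longrightarrow> pair_type (g x) (g y) = pair_type x y"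
  by (simp add: pair_type_def orthogonal_transformation_norm orthogonal_transformation_inj inj_eq)
     (simp add: orthogonal_transformation_def)

text \<open>
  \<open>E\<close> is \<open>{1}\<close> in general and \<open>{1, -1}\<close> for antipodal sets; the points \<open>e *\<^sub>R a\<close> have a
  known position, so their inner products need not be interpolated.
\<close>
definition off_inners :: "real set \<Rightarrow> 'a::real_inner set \<Rightarrow> real \<Rightarrow> real \<Rightarrow> real set" where
  "off_inners E X a b = {u \<bullet> v | u v. u \<in> X \<and> v \<in> X \<and> norm u = a \<and> norm v = b \<and> (\<forall>e\<in>E. v \<noteq> e *\<^sub>R u)}"

text \<open>The origin is included so that the remaining points all have nonzero norm, as the
  isolation of a shell requires.\<close>

definition known_points :: "real set \<Rightarrow> 'a::real_inner \<Rightarrow> 'a \<Rightarrow> 'a set" where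
  "known_points E x y = insert 0 ((\<lambda>e. e *\<^sub>R x) ` E \<union> (\<lambda>e. e *\<^sub>R y) ` E)"

lemma finite_off_inners:
  assumes "finite X"
  shows "finite (off_inners E X a b)"
proof (rule finite_subset)
  show "off_inners E X a b \<subseteq> (\<lambda>(u, v). u \<bullet> v) ` (X \<times> X)"
    by (auto simp: off_inners_def image_iff)
qed (use assms in auto)

text \<open>Each sign is its own inverse, so the excluded position is a symmetric relation.\<close>

lemma eq_sign_scaleR_commute:
  fixes u v :: "'a::real_vector"
  assumes "E \<subseteq> {1, -1 :: real}"
  shows "(\<forall>e\<in>E. v \<noteq> e *\<^sub>R u) \<longleftrightarrow> (\<forall>e\<in>E. u \<noteq> e *\<^sub>R v)"
  using assms by fastforce

lemma off_inners_commute: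
  assumes "E \<subseteq> {1, -1}"
  shows "off_inners E X a b = off_inners E X b a"
proof -
  have "off_inners E X a b \<subseteq> off_inners E X b a" for a b
  proof
    fix s assume "s \<in> off_inners E X a b"
    then obtain u v where "s = u \<bullet> v" "u \<in> X" "v \<in> X" "norm u = a" "norm v = b" "\<forall>e\<in>E. v \<noteq> e *\<^sub>R u"
      unfolding off_inners_def by blast
    moreover from this have "s = v \<bullet> u" "\<forall>e\<in>E. u \<noteq> e *\<^sub>R v"
      using eq_sign_scaleR_commute[OF assms, of v u] by (simp_all add: inner_commute)
    ultimately show "s \<in> off_inners E X b a" unfolding off_inners_def by blast
  qed
  then show ?thesis by blast
qed

lemma known_points_orthogonal:
  assumes "orthogonal_transformation g"
  shows "g ` known_points E x y = known_points E (g x) (g y)"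
  by (simp add: known_points_def image_Un image_image orthogonal_transformation_scaleR[OF assms]
      linear_0[OF orthogonal_transformation_linear[OF assms]])

text \<open>In general \<open>g\<close> does not preserve \<open>X\<close>, but a known point is the
  origin or a multiple of \<open>x\<close> or \<open>y\<close> by an element of \<open>E\<close>.
  Closure of \<open>X\<close> under \<open>E\<close> and linearity of \<open>g\<close> decide its
  membership in \<open>X\<close> before and after applying \<open>g\<close>.\<close>

lemma known_points_Int_orthogonal:
  fixes g :: "'a::real_inner \<Rightarrow> 'a"
  assumes g: "orthogonal_transformation g" and X: "x \<in> X" "y \<in> X" "g x \<in> X" "g y \<in> X"
    and E: "\<And>e z. e \<in> E \<Longrightarrow> z \<in> X \<Longrightarrow> e *\<^sub>R z \<in> X"
  shows "g ` (X \<inter> known_points E x y) = X \<inter> known_points E (g x) (g y)"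
proof -
  have "g z \<in> X \<longleftrightarrow> z \<in> X" if "z \<in> known_points E x y" for z
    using that X E by (auto simp: known_points_def orthogonal_transformation_scaleR[OF g]
      linear_0[OF orthogonal_transformation_linear[OF g]])
  then show ?thesis
    unfolding known_points_orthogonal[OF g, symmetric] by auto
qed

text \<open>A product of linear factors takes one nonzero value \<open>K\<close> on the points to be
  counted and vanishes on the other unknown points of the shell. Its shell sums for the two pairs
  agree by the design property and its sums over known points agree by applying \<open>g\<close>;
  what is left is \<open>K\<close> times the counts.\<close>

lemma card_unknown_points_orthogonal:
  fixes X :: "(real ^ 'n) set"
  assumes des: "euclidean_design t X w p r"
    and wc: "\<And>x y. x \<in> X \<Longrightarrow> y \<in> X \<Longrightarrow> norm x = norm y \<Longrightarrow> w x = w y"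
    and E: "E \<subseteq> {1, -1}" "\<And>e z. e \<in> E \<Longrightarrow> z \<in> X \<Longrightarrow> e *\<^sub>R z \<in> X"
    and bound: "\<And>a b c. a \<in> norm ` X - {0} \<Longrightarrow> b \<in> norm ` X - {0} \<Longrightarrow> c \<in> norm ` X - {0} \<Longrightarrow>
      card (off_inners E X a b) + card (off_inners E X b c) + 2 * card (norm ` X - {0}) \<le> t + 4"
    and g: "orthogonal_transformation g"
    and X: "x \<in> X" "y \<in> X" "g x \<in> X" "g y \<in> X"
    and c: "c \<noteq> 0" and nz: "x \<noteq> 0 \<or> y \<noteq> 0"
  shows "card {z \<in> X - known_points E x y. norm z = c \<and> x \<bullet> z = \<alpha> \<and> z \<bullet> y = \<beta>}
    = card {z \<in> X - known_points E (g x) (g y). norm z = c \<and> g x \<bullet> z = \<alpha> \<and> z \<bullet> g y = \<beta>}"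
proof -
  define Z where "Z u v = {z \<in> X - known_points E u v. norm z = c \<and> u \<bullet> z = \<alpha> \<and> z \<bullet> v = \<beta>}" for u v
  have fin: "finite X"
    using des by (auto simp: euclidean_design_def weighted_set_def)
  note norm_g = orthogonal_transformation_norm[OF g]
  have inner_g: "g u \<bullet> g v = u \<bullet> v" for u v
    using g by (simp add: orthogonal_transformation_def)
  define A where "A = off_inners E X (norm x) c"
  define B where "B = off_inners E X c (norm y)"
  have finAB: "finite A" "finite B" using fin by (simp_all add: A_def B_def finite_off_inners)
  have off: "u \<bullet> z \<in> A" "z \<bullet> v \<in> B"
    if "u \<in> X" "v \<in> X" "norm u = norm x" "norm v = norm y" "z \<in> X - known_points E u v" "norm z = c" for u v z
  proof -
    have *: "\<forall>e\<in>E. z \<noteq> e *\<^sub>R u" "\<forall>e\<in>E. z \<noteq> e *\<^sub>R v"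
      using that by (auto simp: known_points_def)
    then have "\<forall>e\<in>E. v \<noteq> e *\<^sub>R z" using eq_sign_scaleR_commute[OF E(1)] by metis
    with * that show "u \<bullet> z \<in> A" "z \<bullet> v \<in> B" unfolding A_def B_def off_inners_def by blast+
  qed
  have "card (Z x y) = card (Z (g x) (g y))"
  proof (cases "\<alpha> \<in> A \<and> \<beta> \<in> B")
    case False
    then have "Z x y = {}" "Z (g x) (g y) = {}"
      using off[of x y] off[of "g x" "g y"] X norm_g by (auto simp: Z_def)
    then show ?thesis by simp
  next
    case True
    then have cA: "card A > 0" and cB: "card B > 0" using finAB by (auto simp: card_gt_0_iff)
    have cX: "c \<in> norm ` X - {0}" using True c by (auto simp: A_def off_inners_def)
    have zero1: "card A \<le> 1" if "x = 0"
    proof -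
      have "A \<subseteq> {0}" using that by (auto simp: A_def off_inners_def)
      then show ?thesis using card_mono[of "{0}" A] by simp
    qed
    have zero2: "card B \<le> 1" if "y = 0"
    proof -
      have "B \<subseteq> {0}" using that by (auto simp: B_def off_inners_def)
      then show ?thesis using card_mono[of "{0}" B] by simp
    qed
    have A': "A = off_inners E X c (norm x)" and B': "B = off_inners E X (norm y) c"
      using off_inners_commute[OF E(1)] by (auto simp: A_def B_def)
    have "card A + card B + 2 * card (norm ` X - {0}) \<le> t + 4"
    proof (cases "x = 0 \<or> y = 0")
      case False
      then show ?thesis using bound[of "norm x" c "norm y"] X cX by (simp add: A_def B_def)
    next
      \<comment> \<open>The bound speaks of nonzero radii only. If \<open>x = 0\<close>, then
        \<open>A\<close> has at most one element, hence no more than \<open>B\<close>, and the bound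
        for the radii \<open>norm y\<close>, \<open>c\<close>, \<open>norm y\<close> is enough;
        symmetrically if \<open>y = 0\<close>.\<close>
      case True
      have "card A + card A + 2 * card (norm ` X - {0}) \<le> t + 4" if "x \<noteq> 0"
        using bound[of "norm x" c "norm x"] X cX that by (simp add: A_def A'[symmetric, unfolded A_def])
      moreover have "card B + card B + 2 * card (norm ` X - {0}) \<le> t + 4" if "y \<noteq> 0"
        using bound[of "norm y" c "norm y"] X cX that by (simp add: B_def B'[symmetric, unfolded B_def])
      ultimately show ?thesis using True nz zero1 zero2 cA cB by linarith
    qed
    moreover have "card (norm ` X - {0, c}) + 1 = card (norm ` X - {0})"
    proof -
      have "norm ` X - {0, c} = (norm ` X - {0}) - {c}" by auto
      then show ?thesis using fin cX card_Suc_Diff1[of "norm ` X - {0}" c] by simp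
    qed
    moreover have "card (A - {\<alpha>}) + 1 = card A" "card (B - {\<beta>}) + 1 = card B"
      using True finAB card_Suc_Diff1[of A \<alpha>] card_Suc_Diff1[of B \<beta>] by auto
    \<comment> \<open>The 4 in the bound is used up here: omitting \<alpha>, \<beta> and the radius
      \<open>c\<close> saves 1, 1 and 2.\<close>
    ultimately have deg: "(card (A - {\<alpha>}) + card (B - {\<beta>})) + 2 * card (norm ` X - {0, c}) \<le> t"
      by linarith
    \<comment> \<open>An unnormalised Lagrange product in both inner products; \<open>K\<close> is
      its value at (\<alpha>, \<beta>).\<close>
    define f where "f u v z = (\<Prod>d\<in>A - {\<alpha>}. (u \<bullet> z - d)) * (\<Prod>d\<in>B - {\<beta>}. (v \<bullet> z - d))" for u v z :: "real ^ 'n"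
    define K where "K = (\<Prod>d\<in>A - {\<alpha>}. (\<alpha> - d)) * (\<Prod>d\<in>B - {\<beta>}. (\<beta> - d))"
    have "K \<noteq> 0" using finAB by (auto simp: K_def)
    have "poly_fun_le ((\<Sum>d\<in>A - {\<alpha>}. 1) + (\<Sum>d\<in>B - {\<beta>}. 1)) (f u v)" for u v
      unfolding f_def using finAB
      by (intro poly_fun_le_mult poly_fun_le_prod poly_fun_le_diff_const poly_fun_le_inner) auto
    then have "poly_fun_le (card (A - {\<alpha>}) + card (B - {\<beta>})) (f (g x) (g y))" by simp
    \<comment> \<open>Composing \<open>f (g x) (g y)\<close> with \<open>g\<close> gives back
      \<open>f x y\<close>, so this compares the sums belonging to the two pairs.\<close>
    from shell_sum_orthogonal[OF des wc g this deg c]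
    have "(\<Sum>z | z \<in> X \<and> norm z = c. f (g x) (g y) (g z)) = (\<Sum>z | z \<in> X \<and> norm z = c. f (g x) (g y) z)" .
    then have total: "(\<Sum>z | z \<in> X \<and> norm z = c. f x y z) = (\<Sum>z | z \<in> X \<and> norm z = c. f (g x) (g y) z)"
      by (simp add: f_def inner_g)
    have split: "(\<Sum>z | z \<in> X \<and> norm z = c. f u v z)
        = (\<Sum>z | z \<in> X \<inter> known_points E u v \<and> norm z = c. f u v z) + K * real (card (Z u v))"
      if "u \<in> X" "v \<in> X" "norm u = norm x" "norm v = norm y" for u v
    proof -
      let ?Q = "{z \<in> X - known_points E u v. norm z = c}"
      have "{z \<in> X. norm z = c} = {z \<in> X \<inter> known_points E u v. norm z = c} \<union> ?Q" by auto
      then have "(\<Sum>z | z \<in> X \<and> norm z = c. f u v z)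
          = (\<Sum>z | z \<in> X \<inter> known_points E u v \<and> norm z = c. f u v z) + (\<Sum>z\<in>?Q. f u v z)"
        using fin by (simp only:) (rule sum.union_disjoint; auto)
      also have "(\<Sum>z\<in>?Q. f u v z) = (\<Sum>z\<in>Z u v. f u v z)"
      proof (rule sum.mono_neutral_right)
        show "\<forall>z\<in>?Q - Z u v. f u v z = 0"
        proof
          fix z assume z: "z \<in> ?Q - Z u v"
          then have "u \<bullet> z \<in> A" "v \<bullet> z \<in> B" using off[of u v z] that by (auto simp: inner_commute)
          moreover have "u \<bullet> z \<noteq> \<alpha> \<or> v \<bullet> z \<noteq> \<beta>" using z by (auto simp: Z_def inner_commute)
          ultimately show "f u v z = 0" using finAB by (auto simp: f_def)
        qed
      qed (use fin in \<open>auto simp: Z_def\<close>)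
      also have "\<dots> = (\<Sum>z\<in>Z u v. K)"
        by (rule sum.cong) (auto simp: Z_def f_def K_def inner_commute)
      finally show ?thesis by (simp add: mult.commute)
    qed
    \<comment> \<open>On known points the values of \<open>f\<close> are not controlled, since their
      inner products are not among the interpolation nodes by construction; these terms are matched
      one by one through \<open>g\<close>.\<close>
    have "{z \<in> X \<inter> known_points E (g x) (g y). norm z = c} = g ` {z \<in> X \<inter> known_points E x y. norm z = c}"
    proof -
      have "{z \<in> X \<inter> known_points E (g x) (g y). norm z = c}
          = {z \<in> g ` (X \<inter> known_points E x y). norm z = c}"
        by (simp only: known_points_Int_orthogonal[OF g X E(2)])
      also have "\<dots> = g ` {z \<in> X \<inter> known_points E x y. norm z = c}" by (auto simp: norm_g)
      finally show ?thesis .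
    qed
    then have "(\<Sum>z | z \<in> X \<inter> known_points E (g x) (g y) \<and> norm z = c. f (g x) (g y) z)
        = (\<Sum>z | z \<in> X \<inter> known_points E x y \<and> norm z = c. f (g x) (g y) (g z))"
      by (simp only:) (rule sum.reindex_cong[OF _ refl refl],
          rule inj_on_subset[OF orthogonal_transformation_inj[OF g]], simp)
    also have "\<dots> = (\<Sum>z | z \<in> X \<inter> known_points E x y \<and> norm z = c. f x y z)"
      by (simp add: f_def inner_g)
    finally show ?thesis
      using split[of x y] split[of "g x" "g y"] total X norm_g \<open>K \<noteq> 0\<close> by simp
  qed
  then show ?thesis by (simp only: Z_def)
qed

text \<open>Known points with the required types correspond under \<open>g\<close>, and the unknown
  ones are counted shell by shell with the previous lemma. If \<open>x\<close> and \<open>y\<close>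
  are both 0, the types force the two pairs to coincide.\<close>

lemma card_pair_type_eq:
  fixes X :: "(real ^ 'n) set"
  assumes des: "euclidean_design t X w p r"
    and wc: "\<And>x y. x \<in> X \<Longrightarrow> y \<in> X \<Longrightarrow> norm x = norm y \<Longrightarrow> w x = w y"
    and E: "1 \<in> E" "E \<subseteq> {1, -1}" "\<And>e z. e \<in> E \<Longrightarrow> z \<in> X \<Longrightarrow> e *\<^sub>R z \<in> X"
    and bound: "\<And>a b c. a \<in> norm ` X - {0} \<Longrightarrow> b \<in> norm ` X - {0} \<Longrightarrow> c \<in> norm ` X - {0} \<Longrightarrow>
      card (off_inners E X a b) + card (off_inners E X b c) + 2 * card (norm ` X - {0}) \<le> t + 4"
    and X: "x \<in> X" "y \<in> X" "x' \<in> X" "y' \<in> X" and xy: "pair_type x y = pair_type x' y'"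
  shows "card {z \<in> X. pair_type x z = \<alpha> \<and> pair_type z y = \<beta>}
    = card {z \<in> X. pair_type x' z = \<alpha> \<and> pair_type z y' = \<beta>}"
proof (cases "x = 0 \<and> y = 0")
  case True
  then have "x' = x" "y' = y" using xy by (auto simp: pair_type_def)
  then show ?thesis by simp
next
  case False
  obtain g where g: "orthogonal_transformation g" and gxy: "x' = g x" "y' = g y"
    using orthogonal_transformation_pair[of x x' y y'] xy by (auto simp: pair_type_def)
  note X' = X[unfolded gxy]
  note norm_g = orthogonal_transformation_norm[OF g]
  have fin: "finite X"
    using des by (auto simp: euclidean_design_def weighted_set_def)
  define N where "N u v = {z \<in> X. pair_type u z = \<alpha> \<and> pair_type z v = \<beta>}" for u v
  have split: "card (N u v) = card (N u v \<inter> known_points E u v) + card (N u v - known_points E u v)" for u v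
    using fin by (subst card_Un_disjoint[symmetric]) (auto simp: N_def Int_Diff_Un)
  have "N (g x) (g y) \<inter> known_points E (g x) (g y)
      = {z \<in> X \<inter> known_points E (g x) (g y). pair_type (g x) z = \<alpha> \<and> pair_type z (g y) = \<beta>}"
    by (auto simp: N_def)
  also have "\<dots> = {z \<in> g ` (X \<inter> known_points E x y). pair_type (g x) z = \<alpha> \<and> pair_type z (g y) = \<beta>}"
    by (simp only: known_points_Int_orthogonal[OF g X' E(3)])
  also have "\<dots> = g ` (N x y \<inter> known_points E x y)"
    by (auto simp: N_def pair_type_orthogonal[OF g])
  finally have known: "card (N (g x) (g y) \<inter> known_points E (g x) (g y)) = card (N x y \<inter> known_points E x y)"
    by (simp add: card_image inj_on_subset[OF orthogonal_transformation_inj[OF g]])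
  obtain a1 c1 eq1 \<alpha>' where \<alpha>: "\<alpha> = (a1, c1, eq1, \<alpha>')" by (metis prod_cases4)
  obtain c2 b2 eq2 \<beta>' where \<beta>: "\<beta> = (c2, b2, eq2, \<beta>')" by (metis prod_cases4)
  \<comment> \<open>As \<open>1 \<in> E\<close>, the points \<open>u\<close>, \<open>v\<close> and
    the origin are known. An unknown point therefore has nonzero norm and false equality entries;
    types that contradict this, or each other, contribute nothing.\<close>
  have rest: "N u v - known_points E u v =
      (if a1 = norm u \<and> b2 = norm v \<and> c1 = c2 \<and> c1 \<noteq> 0 \<and> \<not> eq1 \<and> \<not> eq2
       then {z \<in> X - known_points E u v. norm z = c1 \<and> u \<bullet> z = \<alpha>' \<and> z \<bullet> v = \<beta>'} else {})" for u v
  proof -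
    have "0 \<in> known_points E u v" "u \<in> known_points E u v" "v \<in> known_points E u v"
      using E(1) by (force simp: known_points_def)+
    then show ?thesis by (auto simp: N_def \<alpha> \<beta> pair_type_def)
  qed
  have "card (N x y - known_points E x y) = card (N (g x) (g y) - known_points E (g x) (g y))"
  proof (cases "a1 = norm x \<and> b2 = norm y \<and> c1 = c2 \<and> c1 \<noteq> 0 \<and> \<not> eq1 \<and> \<not> eq2")
    case True
    then have c1: "c1 \<noteq> 0" by blast
    have nz: "x \<noteq> 0 \<or> y \<noteq> 0" using False by blast
    have "card {z \<in> X - known_points E x y. norm z = c1 \<and> x \<bullet> z = \<alpha>' \<and> z \<bullet> y = \<beta>'}
        = card {z \<in> X - known_points E (g x) (g y). norm z = c1 \<and> g x \<bullet> z = \<alpha>' \<and> z \<bullet> g y = \<beta>'}"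
      by (rule card_unknown_points_orthogonal[OF des wc E(2,3) bound g X' c1 nz])
    then show ?thesis
      unfolding rest norm_g if_P[OF True] .
  next
    case neg: False
    show ?thesis unfolding rest norm_g by (simp only: if_not_P[OF neg])
  qed
  then show ?thesis
    using split[of x y] split[of "g x" "g y"] known unfolding N_def gxy by linarith
qed

section \<open>Coherent configurations from the fibres of a function on pairs\<close>

text \<open>Fibres of a function partition the pairs automatically, so only conditions on \<tau>
  remain to be checked. Indexing the fibres by pairs rather than by values of \<tau> keeps the empty
  set out of the family.\<close>

lemma coherent_configuration_fibres:
  fixes \<tau> :: "'a \<Rightarrow> 'a \<Rightarrow> 'b"
  assumes fin: "finite X"
    and diag: "\<And>x y z. x \<in> X \<Longrightarrow> y \<in> X \<Longrightarrow> z \<in> X \<Longrightarrow> \<tau> x y = \<tau> z z \<Longrightarrow> x = y"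
    and transp: "\<And>x y x' y'. \<tau> x y = \<tau> x' y' \<Longrightarrow> \<tau> y x = \<tau> y' x'"
    and count: "\<And>x y x' y' a b. x \<in> X \<Longrightarrow> y \<in> X \<Longrightarrow> x' \<in> X \<Longrightarrow> y' \<in> X \<Longrightarrow> \<tau> x y = \<tau> x' y' \<Longrightarrow>
      card {z \<in> X. \<tau> x z = a \<and> \<tau> z y = b} = card {z \<in> X. \<tau> x' z = a \<and> \<tau> z y' = b}"
  shows "coherent_configuration X ((\<lambda>(x, y). {(u, v) \<in> X \<times> X. \<tau> u v = \<tau> x y}) ` (X \<times> X))"
proof -
  define F where "F x y = {(u, v) \<in> X \<times> X. \<tau> u v = \<tau> x y}" for x y
  define \<R> where "\<R> = (\<lambda>(x, y). F x y) ` (X \<times> X)"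
  have \<R>E: "\<exists>x\<in>X. \<exists>y\<in>X. R = F x y" if "R \<in> \<R>" for R using that by (auto simp: \<R>_def)
  have F\<R>: "F x y \<in> \<R>" if "x \<in> X" "y \<in> X" for x y using that by (auto simp: \<R>_def)
  have self: "(x, y) \<in> F x y" if "x \<in> X" "y \<in> X" for x y using that by (auto simp: F_def)
  have part: "partition_on (X \<times> X) \<R>"
  proof (rule partition_onI)
    show "\<Union>\<R> = X \<times> X" using self by (auto simp: \<R>_def F_def)
    show "disjnt R S" if "R \<in> \<R>" "S \<in> \<R>" "R \<noteq> S" for R S
      using \<R>E[OF that(1)] \<R>E[OF that(2)] that(3) by (auto simp: F_def disjnt_def)
    show "{} \<notin> \<R>" using \<R>E self by blast
  qed
  have D: "Id_on X = \<Union>((\<lambda>x. F x x) ` X)"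
    using diag by (auto simp: F_def Id_on_def)
  have sub: "(\<lambda>x. F x x) ` X \<subseteq> \<R>" using F\<R> by auto
  have conv: "R\<inverse> \<in> \<R>" if R: "R \<in> \<R>" for R
  proof -
    obtain x y where xy: "x \<in> X" "y \<in> X" "R = F x y" using \<R>E[OF R] by auto
    have "\<tau> u v = \<tau> x y \<longleftrightarrow> \<tau> v u = \<tau> y x" for u v by (rule iffI; rule transp)
    then have "(F x y)\<inverse> = F y x" by (auto simp: F_def)
    then show ?thesis using xy F\<R> by simp
  qed
  have num: "\<exists>q. \<forall>(x, y)\<in>R. card {z \<in> X. (x, z) \<in> S \<and> (z, y) \<in> T} = q"
    if RST: "R \<in> \<R>" "S \<in> \<R>" "T \<in> \<R>" for R S T
  proof -
    obtain x y where R: "x \<in> X" "y \<in> X" "R = F x y" using \<R>E[OF RST(1)] by auto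
    obtain a where S: "S = {(u, v) \<in> X \<times> X. \<tau> u v = a}" using \<R>E[OF RST(2)] by (auto simp: F_def)
    obtain b where T: "T = {(u, v) \<in> X \<times> X. \<tau> u v = b}" using \<R>E[OF RST(3)] by (auto simp: F_def)
    have "card {z \<in> X. (u, z) \<in> S \<and> (z, v) \<in> T} = card {z \<in> X. \<tau> x z = a \<and> \<tau> z y = b}"
      if "(u, v) \<in> R" for u v
    proof -
      have uv: "u \<in> X" "v \<in> X" "\<tau> u v = \<tau> x y" using that R by (auto simp: F_def)
      then have "{z \<in> X. (u, z) \<in> S \<and> (z, v) \<in> T} = {z \<in> X. \<tau> u z = a \<and> \<tau> z v = b}"
        by (auto simp: S T)
      then show ?thesis by (simp only: count[OF uv(1,2) R(1,2) uv(3)])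
    qed
    then show ?thesis by blast
  qed
  have "\<exists>\<D>\<subseteq>\<R>. Id_on X = \<Union>\<D>" using D sub by (intro exI conjI)
  then have "coherent_configuration X \<R>"
    unfolding coherent_configuration_def using fin part conv num by (intro conjI ballI)
  then show ?thesis by (simp only: \<R>_def F_def)
qed

section \<open>Layers, radii and angle sets\<close>

lemma mem_layer_iff: "x \<in> layer X r i \<longleftrightarrow> x \<in> X \<and> norm x = r i"
  by (simp add: layer_def)

lemma norm_image_supported:
  assumes "supported_by_spheres X p r"
  shows "norm ` X = r ` {1..p}"
proof -
  have X: "X = (\<Union>i\<in>{1..p}. layer X r i)" and ne: "\<forall>i\<in>{1..p}. layer X r i \<noteq> {}"
    using assms by (auto simp: supported_by_spheres_def)
  show ?thesis
  proof
    show "norm ` X \<subseteq> r ` {1..p}"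
    proof
      fix a assume "a \<in> norm ` X"
      then obtain x where "x \<in> X" "a = norm x" by blast
      moreover from this X obtain i where "i \<in> {1..p}" "x \<in> layer X r i" by blast
      ultimately show "a \<in> r ` {1..p}" by (auto simp: mem_layer_iff)
    qed
    show "r ` {1..p} \<subseteq> norm ` X"
    proof
      fix a assume "a \<in> r ` {1..p}"
      then obtain i where i: "i \<in> {1..p}" "a = r i" by blast
      with ne obtain x where "x \<in> layer X r i" by blast
      then show "a \<in> norm ` X" unfolding mem_layer_iff i(2) by (metis imageI)
    qed
  qed
qed

lemma layer_eq_zero_iff:
  assumes "supported_by_spheres X p r" "i \<in> {1..p}"
  shows "layer X r i = {0} \<longleftrightarrow> r i = 0"
proof -
  obtain x where x: "x \<in> layer X r i"
    using assms unfolding supported_by_spheres_def by blast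
  show ?thesis
  proof
    assume "layer X r i = {0}"
    then have "0 \<in> layer X r i" by simp
    then show "r i = 0" by (simp add: mem_layer_iff)
  next
    assume "r i = 0"
    then have "y \<in> layer X r i \<Longrightarrow> y = 0" for y by (simp add: mem_layer_iff)
    then show "layer X r i = {0}" using x by fast
  qed
qed

text \<open>Distinct radii and nonempty layers put the indices in bijection with the norms occurring
  in \<open>X\<close>. This reads \<open>p - \<epsilon>\<close> as the number of nonzero
  norms.\<close>

lemma card_nonzero_radii:
  assumes "supported_by_spheres X p r"
  shows "card (norm ` X - {0}) + of_bool (0 \<in> X) = p"
proof -
  have "card (norm ` X) = p"
    using assms by (simp add: norm_image_supported card_image supported_by_spheres_def)
  moreover have "finite (norm ` X)" using assms by (simp add: norm_image_supported)
  moreover have "0 \<in> norm ` X \<longleftrightarrow> 0 \<in> X" by force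
  ultimately show ?thesis
    using card_Suc_Diff1[of "norm ` X" 0] by (cases "0 \<in> X") auto
qed

text \<open>Angles are normalised by the radii, so rescaling recovers the inner products;
  \<open>1 \<in> E\<close> rules out equal points.\<close>

lemma off_inners_subset_angles:
  assumes "1 \<in> E" "r i \<noteq> 0" "r j \<noteq> 0"
  shows "off_inners E X (r i) (r j) \<subseteq> (\<lambda>\<alpha>. r i * r j * \<alpha>) ` angles X r i j"
proof
  fix s assume "s \<in> off_inners E X (r i) (r j)"
  then obtain u v where s: "s = u \<bullet> v" and uv: "u \<in> layer X r i" "v \<in> layer X r j" "\<forall>e\<in>E. v \<noteq> e *\<^sub>R u"
    by (auto simp: off_inners_def mem_layer_iff)
  with \<open>1 \<in> E\<close> have "u \<noteq> v" by force
  with uv have "(u \<bullet> v) / (r i * r j) \<in> angles X r i j" by (auto simp: angles_def)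
  then show "s \<in> (\<lambda>\<alpha>. r i * r j * \<alpha>) ` angles X r i j"
    by (rule rev_image_eqI) (use assms s in simp)
qed

lemma finite_angles: "finite X \<Longrightarrow> finite (angles X r i j)"
  by (rule finite_subset[of _ "(\<lambda>(x, y). (x \<bullet> y) / (r i * r j)) ` (X \<times> X)"])
     (auto simp: angles_def layer_def)

lemma card_off_inners_le:
  assumes "finite X" "1 \<in> E" "r i \<noteq> 0" "r j \<noteq> 0"
  shows "card (off_inners E X (r i) (r j)) \<le> num_angles X r i j"
  unfolding num_angles_def
  by (rule surj_card_le[OF finite_angles off_inners_subset_angles]) (use assms in auto)

text \<open>The angle -1 occurs inside the layer, at \<open>x\<close> and \<open>- x\<close>. By the
  equality case of Cauchy-Schwarz it occurs only for opposite points, which are known points when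
  \<open>E = {1, -1}\<close>. The value thus saved accounts for the Kronecker delta.\<close>

lemma card_off_inners_antipodal_less:
  fixes X :: "(real ^ 'n) set"
  assumes fin: "finite X" and anti: "antipodal X" and x: "x \<in> layer X r i" and ri: "r i \<noteq> 0"
  shows "card (off_inners {1, -1} X (r i) (r i)) < num_angles X r i i"
proof -
  let ?D = "off_inners {1, -1} X (r i) (r i)"
  have "- (r i * r i) \<notin> ?D"
  proof
    assume "- (r i * r i) \<in> ?D"
    then obtain u v :: "real ^ 'n" where uv: "u \<bullet> v = - (r i * r i)" "norm u = r i" "norm v = r i" "\<forall>e\<in>{1, -1}. v \<noteq> e *\<^sub>R u"
      unfolding off_inners_def by fastforce
    then have "v \<noteq> - u" by simp
    then have "u \<bullet> u = r i * r i" "v \<bullet> v = r i * r i"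
      using uv(2,3) power2_norm_eq_inner[of u] power2_norm_eq_inner[of v] by (simp_all add: power2_eq_square)
    with uv(1) have "(u + v) \<bullet> (u + v) = 0" by (simp add: inner_simps inner_commute[of v u])
    then have "v = - u" by (simp add: eq_neg_iff_add_eq_0 add.commute)
    with \<open>v \<noteq> - u\<close> show False by simp
  qed
  moreover have "- (r i * r i) \<in> (\<lambda>\<alpha>. r i * r i * \<alpha>) ` angles X r i i"
  proof -
    have nx: "norm x = r i" "x \<in> X" using x by (auto simp: mem_layer_iff)
    then have "- x \<in> layer X r i" using anti by (auto simp: mem_layer_iff antipodal_def)
    moreover have "x \<noteq> - x"
    proof
      assume "x = - x"
      then have "2 *\<^sub>R x = 0" by (simp only: scaleR_2 eq_neg_iff_add_eq_0)
      then show False using nx ri by simp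
    qed
    ultimately have "(x \<bullet> - x) / (r i * r i) \<in> angles X r i i"
      using x unfolding angles_def by blast
    moreover have "x \<bullet> x = r i * r i" using nx(1) power2_norm_eq_inner[of x] by (simp add: power2_eq_square)
    ultimately show ?thesis by (intro image_eqI[of _ _ "(x \<bullet> - x) / (r i * r i)"]) (use ri in auto)
  qed
  ultimately have "card (insert (- (r i * r i)) ?D) = Suc (card ?D)"
    and sub: "insert (- (r i * r i)) ?D \<subseteq> (\<lambda>\<alpha>. r i * r i * \<alpha>) ` angles X r i i"
    using off_inners_subset_angles[of "{1, -1}" r i i X] ri by (auto simp: finite_off_inners[OF fin])
  then show ?thesis
    using surj_card_le[OF finite_angles[OF fin] sub] unfolding num_angles_def by simp
qed

text \<open>A pair falls into exactly one kind of class, according to whether its points coincide or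
  one of them is 0. Conversely, nonempty layers and the definition of \<open>angles\<close> supply a
  representative pair for each listed class. For the layer \<open>{0}\<close> the diagonal and
  \<open>{(0, 0)}\<close> are the same member of the set.\<close>

lemma angle_relations_eq_fibres:
  fixes X :: "(real ^ 'n) set"
  assumes sup: "supported_by_spheres X p r"
  shows "angle_relations X p r
    = (\<lambda>(x, y). {(u, v) \<in> X \<times> X. pair_type u v = pair_type x y}) ` (X \<times> X)"
proof -
  define F where "F x y = {(u, v) \<in> X \<times> X. pair_type u v = pair_type x y}" for x y :: "real ^ 'n"
  have radius: "\<exists>i\<in>{1..p}. x \<in> layer X r i" if "x \<in> X" for x
  proof -
    have "norm x \<in> r ` {1..p}" using that norm_image_supported[OF sup] by blast
    then show ?thesis using that by (auto simp: mem_layer_iff)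
  qed
  have point: "\<exists>x. x \<in> layer X r i" if "i \<in> {1..p}" for i
    using sup that by (auto simp: supported_by_spheres_def)
  have nz: "layer X r i \<noteq> {0} \<longleftrightarrow> r i \<noteq> 0" if "i \<in> {1..p}" for i
    using layer_eq_zero_iff[OF sup that] by simp
  have F_off: "F x y = {(u, v). u \<in> layer X r i \<and> v \<in> layer X r j \<and> u \<noteq> v \<and> u \<bullet> v = x \<bullet> y}"
    if "x \<in> layer X r i" "y \<in> layer X r j" "x \<noteq> y" for x y i j
    using that by (auto simp: F_def pair_type_def mem_layer_iff)
  have F_angle: "F x y = angle_class X r i j ((x \<bullet> y) / (r i * r j))"
    if "x \<in> layer X r i" "y \<in> layer X r j" "x \<noteq> y" "r i \<noteq> 0" "r j \<noteq> 0" for x y i j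
    unfolding F_off[OF that(1-3)] angle_class_def using that(4,5) by simp
  have F_diag: "F x x = Id_on (layer X r i)" if "x \<in> layer X r i" for x i
    using that by (auto simp: F_def pair_type_def mem_layer_iff simp flip: power2_norm_eq_inner)
  have F_zero_left: "F 0 y = {0} \<times> layer X r j" if "0 \<in> X" "y \<in> layer X r j" "r j \<noteq> 0" for y j
    using that by (auto simp: F_def pair_type_def mem_layer_iff)
  have F_zero_right: "F x 0 = layer X r i \<times> {0}" if "0 \<in> X" "x \<in> layer X r i" "r i \<noteq> 0" for x i
    using that by (auto simp: F_def pair_type_def mem_layer_iff)
  have F_zero: "F 0 0 = {(0, 0)}" if "(0 :: real ^ 'n) \<in> X"
    using that by (auto simp: F_def pair_type_def)
  have FI: "F x y \<in> (\<lambda>(x, y). F x y) ` (X \<times> X)" if "x \<in> X" "y \<in> X" for x y using that by auto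
  have angle: "angle_class X r i j \<alpha> \<in> (\<lambda>(x, y). F x y) ` (X \<times> X)"
    if "i \<in> {1..p}" "j \<in> {1..p}" "layer X r i \<noteq> {0}" "layer X r j \<noteq> {0}" "\<alpha> \<in> angles X r i j" for i j \<alpha>
  proof -
    obtain x y where "x \<in> layer X r i" "y \<in> layer X r j" "x \<noteq> y" "\<alpha> = (x \<bullet> y) / (r i * r j)"
      using \<open>\<alpha> \<in> angles X r i j\<close> unfolding angles_def by blast
    then show ?thesis using that nz FI[of x y] F_angle[of x i y j] by (simp add: mem_layer_iff)
  qed
  have diag: "Id_on (layer X r i) \<in> (\<lambda>(x, y). F x y) ` (X \<times> X)" if "i \<in> {1..p}" for i
  proof -
    obtain x where "x \<in> layer X r i" using point[OF \<open>i \<in> {1..p}\<close>] by (rule exE)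
    then show ?thesis using FI[of x x] F_diag[of x i] by (simp add: mem_layer_iff)
  qed
  have zero: "{(0, 0)} \<in> (\<lambda>(x, y). F x y) ` (X \<times> X)" if "0 \<in> X"
    using that FI[of 0 0] F_zero by simp
  have left: "{0} \<times> layer X r j \<in> (\<lambda>(x, y). F x y) ` (X \<times> X)"
    if "0 \<in> X" "j \<in> {1..p}" "layer X r j \<noteq> {0}" for j
  proof -
    obtain x where "x \<in> layer X r j" using point[OF \<open>j \<in> {1..p}\<close>] by (rule exE)
    then show ?thesis using that nz FI[of 0 x] F_zero_left[of x j] by (simp add: mem_layer_iff)
  qed
  have right: "layer X r i \<times> {0} \<in> (\<lambda>(x, y). F x y) ` (X \<times> X)"
    if "0 \<in> X" "i \<in> {1..p}" "layer X r i \<noteq> {0}" for i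
  proof -
    obtain x where "x \<in> layer X r i" using point[OF \<open>i \<in> {1..p}\<close>] by (rule exE)
    then show ?thesis using that nz FI[of x 0] F_zero_right[of x i] by (simp add: mem_layer_iff)
  qed
  have "angle_relations X p r \<subseteq> (\<lambda>(x, y). F x y) ` (X \<times> X)"
  proof (cases "0 \<in> X")
    case True
    show ?thesis
      unfolding angle_relations_def if_P[OF True]
      by (intro Un_least subsetI; elim CollectE exE conjE singletonE; hypsubst;
          (rule angle diag zero[OF True] left[OF True] right[OF True]; assumption))
  next
    case False
    show ?thesis
      unfolding angle_relations_def if_not_P[OF False]
      by (intro Un_least subsetI empty_subsetI; elim CollectE exE conjE; hypsubst;
          (rule angle diag; assumption))
  qed
  moreover have "F x y \<in> angle_relations X p r" if xy: "x \<in> X" "y \<in> X" for x y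
  proof -
    obtain i j where i: "i \<in> {1..p}" "x \<in> layer X r i" and j: "j \<in> {1..p}" "y \<in> layer X r j"
      using radius[OF xy(1)] radius[OF xy(2)] by blast
    have r0: "r i = 0 \<longleftrightarrow> x = 0" "r j = 0 \<longleftrightarrow> y = 0" using i j by (auto simp: mem_layer_iff)
    consider "x = y" | "x \<noteq> y" "x = 0" | "x \<noteq> y" "y = 0" | "x \<noteq> y" "x \<noteq> 0" "y \<noteq> 0" by blast
    then show ?thesis
    proof cases
      case 1
      then have "F x y = Id_on (layer X r i)" using F_diag i by simp
      then show ?thesis unfolding angle_relations_def using i by blast
    next
      case 2
      then have "F x y = {0} \<times> layer X r j" "0 \<in> X" "layer X r j \<noteq> {0}"
        using F_zero_left j r0 xy nz by auto
      then show ?thesis unfolding angle_relations_def using j(1) by auto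
    next
      case 3
      then have "F x y = layer X r i \<times> {0}" "0 \<in> X" "layer X r i \<noteq> {0}"
        using F_zero_right i r0 xy nz by auto
      then show ?thesis unfolding angle_relations_def using i(1) by auto
    next
      case 4
      then have "F x y = angle_class X r i j ((x \<bullet> y) / (r i * r j))"
        using F_angle i j r0 by blast
      moreover have "(x \<bullet> y) / (r i * r j) \<in> angles X r i j"
        unfolding angles_def using i j 4 by blast
      moreover have "layer X r i \<noteq> {0}" "layer X r j \<noteq> {0}" using 4 r0 nz i j by auto
      ultimately show ?thesis unfolding angle_relations_def using i(1) j(1) by blast
    qed
  qed
  ultimately have "angle_relations X p r = (\<lambda>(x, y). F x y) ` (X \<times> X)" by auto
  then show ?thesis by (simp only: F_def)
qed

section \<open>Coherence under either degree hypothesis\<close>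

theorem theorem1p4:
  fixes X :: "(real ^ 'n) set" and w :: "real ^ 'n \<Rightarrow> real"
    and t p :: nat and r :: "nat \<Rightarrow> real" and \<omega> :: "nat \<Rightarrow> real" and \<epsilon> :: int
  assumes "CARD('n) \<ge> 2"
    and "euclidean_design t X w p r"
    and "\<forall>\<nu>\<in>{1..p}. \<forall>x\<in>layer X r \<nu>. w x = \<omega> \<nu>"
    and "\<epsilon> = (if 0 \<in> X then 1 else 0)"
    and "(\<forall>\<kappa>\<in>{1..p}. \<forall>\<nu>\<in>{1..p}. \<forall>\<mu>\<in>{1..p}.
            layer X r \<kappa> \<noteq> {0} \<and> layer X r \<nu> \<noteq> {0} \<and> layer X r \<mu> \<noteq> {0} \<longrightarrow>
            int (num_angles X r \<kappa> \<nu>) + int (num_angles X r \<nu> \<mu>)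
              \<le> int t - 2 * (int p - \<epsilon> - 2))
       \<or> (antipodal X \<and>
          (\<forall>\<kappa>\<in>{1..p}. \<forall>\<nu>\<in>{1..p}. \<forall>\<mu>\<in>{1..p}.
            layer X r \<kappa> \<noteq> {0} \<and> layer X r \<nu> \<noteq> {0} \<and> layer X r \<mu> \<noteq> {0} \<longrightarrow>
            int (num_angles X r \<kappa> \<nu>) + int (num_angles X r \<nu> \<mu>)
                - of_bool (\<kappa> = \<nu>) - of_bool (\<nu> = \<mu>)
              \<le> int t - 2 * (int p - \<epsilon> - 2)))"
  shows "coherent_configuration X (angle_relations X p r)"
proof -
  have sup: "supported_by_spheres X p r" and fin: "finite X"
    using assms(2) by (auto simp: euclidean_design_def weighted_set_def)
  have radius: "\<exists>i\<in>{1..p}. a = r i" if "a \<in> norm ` X" for a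
    using that unfolding norm_image_supported[OF sup] by blast
  have wc: "w x = w y" if "x \<in> X" "y \<in> X" "norm x = norm y" for x y
  proof -
    from radius[OF imageI[where f = norm, OF that(1)]]
    obtain i where i: "i \<in> {1..p}" "norm x = r i" by (rule bexE)
    have "norm y = r i" by (rule trans[OF that(3)[symmetric] i(2)])
    with i(2) that(1,2) have xy: "x \<in> layer X r i" "y \<in> layer X r i"
      by (simp_all only: mem_layer_iff HOL.simp_thms)
    have "w x = \<omega> i" "w y = \<omega> i"
      using bspec[OF bspec[OF assms(3) i(1)] xy(1)] bspec[OF bspec[OF assms(3) i(1)] xy(2)] by simp_all
    then show ?thesis by simp
  qed
  have p: "int (card (norm ` X - {0})) = int p - \<epsilon>"
    using card_nonzero_radii[OF sup] assms(4) by (cases "0 \<in> X") auto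
  have layer_nz: "layer X r i \<noteq> {0} \<and> layer X r j \<noteq> {0} \<and> layer X r k \<noteq> {0}"
    if "i \<in> {1..p}" "j \<in> {1..p}" "k \<in> {1..p}" "r i \<noteq> 0 \<and> r j \<noteq> 0 \<and> r k \<noteq> 0" for i j k
    using that layer_eq_zero_iff[OF sup] by simp
  \<comment> \<open>Both hypotheses are brought to one bound on \<open>off_inners\<close>, with
    \<open>E = {1}\<close> for the first and \<open>E = {1, -1}\<close> for the antipodal
    one.\<close>
  have "\<exists>E. 1 \<in> E \<and> E \<subseteq> {1, -1} \<and> (\<forall>e\<in>E. \<forall>z\<in>X. e *\<^sub>R z \<in> X) \<and>
      (\<forall>i\<in>{1..p}. \<forall>j\<in>{1..p}. \<forall>k\<in>{1..p}. r i \<noteq> 0 \<and> r j \<noteq> 0 \<and> r k \<noteq> 0 \<longrightarrow>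
        int (card (off_inners E X (r i) (r j))) + int (card (off_inners E X (r j) (r k)))
          \<le> int t - 2 * (int p - \<epsilon> - 2))"
    using assms(5)
  proof
    assume *: "\<forall>\<kappa>\<in>{1..p}. \<forall>\<nu>\<in>{1..p}. \<forall>\<mu>\<in>{1..p}.
            layer X r \<kappa> \<noteq> {0} \<and> layer X r \<nu> \<noteq> {0} \<and> layer X r \<mu> \<noteq> {0} \<longrightarrow>
            int (num_angles X r \<kappa> \<nu>) + int (num_angles X r \<nu> \<mu>)
              \<le> int t - 2 * (int p - \<epsilon> - 2)"
    show ?thesis
    proof (intro exI[of _ "{1}"] conjI ballI impI)
      fix i j k assume ijk: "i \<in> {1..p}" "j \<in> {1..p}" "k \<in> {1..p}" "r i \<noteq> 0 \<and> r j \<noteq> 0 \<and> r k \<noteq> 0"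
      have "int (num_angles X r i j) + int (num_angles X r j k) \<le> int t - 2 * (int p - \<epsilon> - 2)"
        by (rule *[rule_format, OF ijk(1-3) layer_nz[OF ijk]])
      then show "int (card (off_inners {1} X (r i) (r j))) + int (card (off_inners {1} X (r j) (r k)))
          \<le> int t - 2 * (int p - \<epsilon> - 2)"
        using card_off_inners_le[OF fin, of "{1}" r i j] card_off_inners_le[OF fin, of "{1}" r j k] ijk by simp
    qed auto
  next
    assume *: "antipodal X \<and> (\<forall>\<kappa>\<in>{1..p}. \<forall>\<nu>\<in>{1..p}. \<forall>\<mu>\<in>{1..p}.
            layer X r \<kappa> \<noteq> {0} \<and> layer X r \<nu> \<noteq> {0} \<and> layer X r \<mu> \<noteq> {0} \<longrightarrow>
            int (num_angles X r \<kappa> \<nu>) + int (num_angles X r \<nu> \<mu>)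
                - of_bool (\<kappa> = \<nu>) - of_bool (\<nu> = \<mu>)
              \<le> int t - 2 * (int p - \<epsilon> - 2))"
    have le: "int (card (off_inners {1, -1} X (r i) (r j))) \<le> int (num_angles X r i j) - of_bool (i = j)"
      if "i \<in> {1..p}" "j \<in> {1..p}" "r i \<noteq> 0" "r j \<noteq> 0" for i j
    proof (cases "i = j")
      case True
      obtain x where "x \<in> layer X r i" using sup \<open>i \<in> {1..p}\<close> unfolding supported_by_spheres_def by blast
      then show ?thesis using card_off_inners_antipodal_less[OF fin, of x r i] * that True by simp
    next
      case False
      then show ?thesis using card_off_inners_le[OF fin, of "{1, -1}" r i j] that by simp
    qed
    show ?thesis
    proof (intro exI[of _ "{1, -1}"] conjI ballI impI)
      fix i j k assume ijk: "i \<in> {1..p}" "j \<in> {1..p}" "k \<in> {1..p}" "r i \<noteq> 0 \<and> r j \<noteq> 0 \<and> r k \<noteq> 0"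
      have "int (num_angles X r i j) + int (num_angles X r j k) - of_bool (i = j) - of_bool (j = k)
          \<le> int t - 2 * (int p - \<epsilon> - 2)"
        by (rule conjunct2[OF *, rule_format, OF ijk(1-3) layer_nz[OF ijk]])
      then show "int (card (off_inners {1, -1} X (r i) (r j))) + int (card (off_inners {1, -1} X (r j) (r k)))
          \<le> int t - 2 * (int p - \<epsilon> - 2)"
        using le[of i j] le[of j k] ijk by linarith
    next
      fix e :: real and z assume "e \<in> {1, -1}" "z \<in> X"
      moreover have "- z \<in> X" if "z \<in> X" for z using * that unfolding antipodal_def by blast
      ultimately show "e *\<^sub>R z \<in> X" by auto
    qed auto
  qed
  then obtain E where E1: "1 \<in> E" "E \<subseteq> {1, -1}" and E2: "\<forall>e\<in>E. \<forall>z\<in>X. e *\<^sub>R z \<in> X"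
    and E3: "\<forall>i\<in>{1..p}. \<forall>j\<in>{1..p}. \<forall>k\<in>{1..p}. r i \<noteq> 0 \<and> r j \<noteq> 0 \<and> r k \<noteq> 0 \<longrightarrow>
        int (card (off_inners E X (r i) (r j))) + int (card (off_inners E X (r j) (r k)))
          \<le> int t - 2 * (int p - \<epsilon> - 2)"
    by (elim exE conjE) (rule that)
  \<comment> \<open>With \<open>p - \<epsilon>\<close> read as the number of nonzero norms, moving
    the subtracted term to the left leaves \<open>t + 4\<close> on the right, a form without
    subtraction on natural numbers.\<close>
  have bound: "card (off_inners E X a b) + card (off_inners E X b c) + 2 * card (norm ` X - {0}) \<le> t + 4"
    if "a \<in> norm ` X - {0}" "b \<in> norm ` X - {0}" "c \<in> norm ` X - {0}" for a b c
  proof -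
    from radius[OF DiffD1[OF that(1)]] obtain i where i: "i \<in> {1..p}" "a = r i" by (rule bexE)
    from radius[OF DiffD1[OF that(2)]] obtain j where j: "j \<in> {1..p}" "b = r j" by (rule bexE)
    from radius[OF DiffD1[OF that(3)]] obtain k where k: "k \<in> {1..p}" "c = r k" by (rule bexE)
    show ?thesis using E3[rule_format, of i j k] i j k that p by simp
  qed
  show ?thesis
    unfolding angle_relations_eq_fibres[OF sup]
  proof (rule coherent_configuration_fibres[OF fin])
    show "x = y" if "pair_type x y = pair_type z z" for x y z :: "real ^ 'n"
      using that by (simp add: pair_type_def)
    show "pair_type y x = pair_type y' x'" if "pair_type x y = pair_type x' y'" for x y x' y' :: "real ^ 'n"
      using that by (auto simp: pair_type_def inner_commute)
    show "card {z \<in> X. pair_type x z = a \<and> pair_type z y = b} = card {z \<in> X. pair_type x' z = a \<and> pair_type z y' = b}"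
      if "x \<in> X" "y \<in> X" "x' \<in> X" "y' \<in> X" "pair_type x y = pair_type x' y'" for x y x' y' a b
      by (rule card_pair_type_eq[OF assms(2) wc E1 E2[rule_format] bound that])
  qed
qed

end
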